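(* Let $K$ be a commutative ring and let $M|N$ be an irreducible, depth two Frobenius extension of $K$-algebras. Let $B=(M\otimes_NM)^N$ with multiplication $bb'={b'}^1b^1\otimes b^2{b'}^2$ and unit $1\otimes1$. Then $M|N$ is a separable extension if and only if $B$ is a separable $K$-algebra.
   Context: A $K$-algebra extension $N\to M$ is irreducible if the centralizer $R=C_M(N)$ equals $K1_M$ ($K$ being identified with $R$ via $k\mapsto k1_M$); D2 (depth two) if $M\otimes_NM$ is isomorphic to a direct summand of $\oplus^n\,{}_NM_M$ as an $N$-$M$-bimodule and of $\oplus^m\,{}_MM_N$ as an $M$-$N$-bimodule, for some $n,m\ge1$; Frobenius if there are an $N$-$N$-bimodule map $E:M\to N$ and finitely many $x_i,y_i\in M$ with $\sum_ix_iE(y_im)=m=\sum_iE(mx_i)y_i$ for all $m\in M$; separable if the multiplication map $M\otimes_NM\to M$ is a split $M$-$M$-bimodule epimorphism. $(M\otimes_NM)^N=\{b\in M\otimes_NM:nb=bn\ \forall n\in N\}$, with elements written $b=b^1\otimes b^2$ (summation suppressed). *)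

theory Defs
  imports "HOL-Algebra.Free_Abelian_Groups" "HOL-Algebra.Module" "HOL-Algebra.RingHom"
begin

section \<open>Algebras and extensions\<close>

text \<open>The library locale \<open>algebra\<close> asks for commutativity, so associative unital algebras that need
  not be commutative are introduced here. Rings may be zero.\<close>

locale assoc_algebra = module K A + A?: ring A for K (structure) and A (structure) +
  assumes smult_mult_left: "\<lbrakk>k \<in> carrier K; x \<in> carrier A; y \<in> carrier A\<rbrakk> \<Longrightarrow>
      (k \<odot>\<^bsub>A\<^esub> x) \<otimes>\<^bsub>A\<^esub> y = k \<odot>\<^bsub>A\<^esub> (x \<otimes>\<^bsub>A\<^esub> y)"
    and smult_mult_right: "\<lbrakk>k \<in> carrier K; x \<in> carrier A; y \<in> carrier A\<rbrakk> \<Longrightarrow>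
      x \<otimes>\<^bsub>A\<^esub> (k \<odot>\<^bsub>A\<^esub> y) = k \<odot>\<^bsub>A\<^esub> (x \<otimes>\<^bsub>A\<^esub> y)"

text \<open>The structure map \<open>\<eta>\<close> is a unital homomorphism of algebras; it need not be injective.\<close>

locale algebra_extension =
  N: assoc_algebra K N + M: assoc_algebra K M
  for K (structure) and N (structure) and M (structure) and \<eta> +
  assumes eta_hom: "\<eta> \<in> ring_hom N M"
    and eta_smult: "\<lbrakk>k \<in> carrier K; n \<in> carrier N\<rbrakk> \<Longrightarrow> \<eta> (k \<odot>\<^bsub>N\<^esub> n) = k \<odot>\<^bsub>M\<^esub> \<eta> n"

definition centralizer where
  "centralizer N M \<eta> =
     {m \<in> carrier M. \<forall>n \<in> carrier N. \<eta> n \<otimes>\<^bsub>M\<^esub> m = m \<otimes>\<^bsub>M\<^esub> \<eta> n}"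

text \<open>The centralizer is \<open>K1\<close> and is identified with \<open>K\<close> along \<open>k \<mapsto> k1\<close>.\<close>

definition irreducible_extension where
  "irreducible_extension K N M \<eta> \<longleftrightarrow>
     bij_betw (\<lambda>k. k \<odot>\<^bsub>M\<^esub> \<one>\<^bsub>M\<^esub>) (carrier K) (centralizer N M \<eta>)"

section \<open>Bimodules\<close>

text \<open>As in the library record \<open>module\<close>, the underlying abelian group is the additive part of a ring
  record; the fields \<open>mult\<close> and \<open>one\<close> play no role for bimodules.\<close>

record ('p, 'q, 'b) bimodule = "'b ring" +
  lact :: "'p \<Rightarrow> 'b \<Rightarrow> 'b"
  ract :: "'b \<Rightarrow> 'q \<Rightarrow> 'b"

definition regular_bimodule :: "('m, 'x) ring_scheme \<Rightarrow> ('m, 'm, 'm) bimodule" where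
  "regular_bimodule M = \<lparr>carrier = carrier M, monoid.mult = monoid.mult M, monoid.one = monoid.one M,
     ring.zero = ring.zero M, ring.add = ring.add M,
     lact = monoid.mult M, ract = monoid.mult M\<rparr>"

definition restrict_scalars ::
    "('p1 \<Rightarrow> 'p) \<Rightarrow> ('q1 \<Rightarrow> 'q) \<Rightarrow> ('p, 'q, 'b) bimodule \<Rightarrow> ('p1, 'q1, 'b) bimodule" where
  "restrict_scalars f g U = \<lparr>carrier = carrier U, monoid.mult = monoid.mult U, monoid.one = monoid.one U,
     ring.zero = ring.zero U, ring.add = ring.add U,
     lact = (\<lambda>p. lact U (f p)), ract = (\<lambda>x q. ract U x (g q))\<rparr>"

definition bimodule_hom ::
    "('p, 'y) ring_scheme \<Rightarrow> ('q, 'z) ring_scheme \<Rightarrow> ('p, 'q, 'b) bimodule \<Rightarrow>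
     ('p, 'q, 'c) bimodule \<Rightarrow> ('b \<Rightarrow> 'c) set" where
  "bimodule_hom P Q U V = {f \<in> carrier U \<rightarrow> carrier V.
     (\<forall>x \<in> carrier U. \<forall>y \<in> carrier U. f (x \<oplus>\<^bsub>U\<^esub> y) = f x \<oplus>\<^bsub>V\<^esub> f y) \<and>
     (\<forall>p \<in> carrier P. \<forall>x \<in> carrier U. f (lact U p x) = lact V p (f x)) \<and>
     (\<forall>q \<in> carrier Q. \<forall>x \<in> carrier U. f (ract U x q) = ract V (f x) q)}"

definition split_bimodule_epi where
  "split_bimodule_epi P Q U V f \<longleftrightarrow> f \<in> bimodule_hom P Q U V \<and>
     (\<exists>s \<in> bimodule_hom P Q V U. \<forall>y \<in> carrier V. f (s y) = y)"

definition subbimodule where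
  "subbimodule P Q S U \<longleftrightarrow> additive_subgroup S U \<and>
     (\<forall>p \<in> carrier P. \<forall>x \<in> S. lact U p x \<in> S) \<and> (\<forall>q \<in> carrier Q. \<forall>x \<in> S. ract U x q \<in> S)"

definition iso_direct_summand ::
    "('p, 'y) ring_scheme \<Rightarrow> ('q, 'z) ring_scheme \<Rightarrow> ('p, 'q, 'b) bimodule \<Rightarrow>
     ('p, 'q, 'c) bimodule \<Rightarrow> bool" where
  "iso_direct_summand P Q U V \<longleftrightarrow> (\<exists>S T.
     subbimodule P Q S V \<and> subbimodule P Q T V \<and> S \<inter> T = {\<zero>\<^bsub>V\<^esub>} \<and> S <+>\<^bsub>V\<^esub> T = carrier V \<and>
     (\<exists>f \<in> bimodule_hom P Q U (V\<lparr>carrier := S\<rparr>). bij_betw f (carrier U) S))"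

definition direct_power ::
    "nat \<Rightarrow> ('p, 'q, 'b) bimodule \<Rightarrow> ('p, 'q, nat \<Rightarrow> 'b) bimodule" where
  "direct_power n U = \<lparr>carrier = {..<n} \<rightarrow>\<^sub>E carrier U,
     monoid.mult = undefined, monoid.one = undefined,
     ring.zero = (\<lambda>i\<in>{..<n}. \<zero>\<^bsub>U\<^esub>), ring.add = (\<lambda>x y. \<lambda>i\<in>{..<n}. x i \<oplus>\<^bsub>U\<^esub> y i),
     lact = (\<lambda>p x. \<lambda>i\<in>{..<n}. lact U p (x i)), ract = (\<lambda>x q. \<lambda>i\<in>{..<n}. ract U (x i) q)\<rparr>"

section \<open>Tensor products\<close>

text \<open>\<open>P \<otimes>\<^sub>N Q\<close> is the free abelian group on \<open>P \<times> Q\<close> modulo the subgroup generated by the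
  biadditivity and \<open>N\<close>-balancing relators; tensors are thus cosets of formal sums of pairs.\<close>

abbreviation tensor_free ::
    "('p, 'n, 'a) bimodule \<Rightarrow> ('n, 'q, 'b) bimodule \<Rightarrow> ('a \<times> 'b \<Rightarrow>\<^sub>0 int) monoid" where
  "tensor_free P Q \<equiv> free_Abelian_group (carrier P \<times> carrier Q)"

definition tensor_rel ::
    "('n, 'x) ring_scheme \<Rightarrow> ('p, 'n, 'a) bimodule \<Rightarrow> ('n, 'q, 'b) bimodule \<Rightarrow>
     ('a \<times> 'b \<Rightarrow>\<^sub>0 int) set" where
  "tensor_rel N P Q = generate (tensor_free P Q)
     ({frag_of (x \<oplus>\<^bsub>P\<^esub> x', y) - frag_of (x, y) - frag_of (x', y) | x x' y.
         x \<in> carrier P \<and> x' \<in> carrier P \<and> y \<in> carrier Q} \<union>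
      {frag_of (x, y \<oplus>\<^bsub>Q\<^esub> y') - frag_of (x, y) - frag_of (x, y') | x y y'.
         x \<in> carrier P \<and> y \<in> carrier Q \<and> y' \<in> carrier Q} \<union>
      {frag_of (ract P x n, y) - frag_of (x, lact Q n y) | x n y.
         x \<in> carrier P \<and> n \<in> carrier N \<and> y \<in> carrier Q})"

text \<open>The outer actions are applied to representatives; multiplying the image of a coset by the
  relator subgroup makes it a full coset again.\<close>

definition tensor_product ::
    "('n, 'x) ring_scheme \<Rightarrow> ('p, 'n, 'a) bimodule \<Rightarrow> ('n, 'q, 'b) bimodule \<Rightarrow>
     ('p, 'q, ('a \<times> 'b \<Rightarrow>\<^sub>0 int) set) bimodule" where
  "tensor_product N P Q =
    \<lparr>carrier = rcosets\<^bsub>tensor_free P Q\<^esub> (tensor_rel N P Q),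
     monoid.mult = undefined, monoid.one = undefined,
     ring.zero = tensor_rel N P Q, ring.add = (\<lambda>U V. U <#>\<^bsub>tensor_free P Q\<^esub> V),
     lact = (\<lambda>p U. tensor_rel N P Q <#>\<^bsub>tensor_free P Q\<^esub>
        (frag_extend (\<lambda>(x, y). frag_of (lact P p x, y)) ` U)),
     ract = (\<lambda>U q. tensor_rel N P Q <#>\<^bsub>tensor_free P Q\<^esub>
        (frag_extend (\<lambda>(x, y). frag_of (x, ract Q y q)) ` U))\<rparr>"

text \<open>In \<open>M \<otimes>\<^sub>N M\<close> the left factor is an \<open>M\<close>-\<open>N\<close>-bimodule and the right factor an
  \<open>N\<close>-\<open>M\<close>-bimodule, so the result is an \<open>M\<close>-\<open>M\<close>-bimodule.\<close>

abbreviation as_MN where "as_MN M \<eta> \<equiv> restrict_scalars (\<lambda>m. m) \<eta> (regular_bimodule M)"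

abbreviation as_NM where "as_NM M \<eta> \<equiv> restrict_scalars \<eta> (\<lambda>m. m) (regular_bimodule M)"

definition tensor_square ::
    "('n, 'x) ring_scheme \<Rightarrow> ('m, 'y) ring_scheme \<Rightarrow> ('n \<Rightarrow> 'm) \<Rightarrow>
     ('m, 'm, ('m \<times> 'm \<Rightarrow>\<^sub>0 int) set) bimodule" where
  "tensor_square N M \<eta> = tensor_product N (as_MN M \<eta>) (as_NM M \<eta>)"

text \<open>The multiplication map \<open>x \<otimes> y \<mapsto> xy\<close>, evaluated on representatives.\<close>

definition mult_map ::
    "('m, 'y) ring_scheme \<Rightarrow> ('m \<times> 'm \<Rightarrow>\<^sub>0 int) set \<Rightarrow> 'm" where
  "mult_map M U = the_elem ((\<lambda>c. finsum M (\<lambda>(x, y). [Poly_Mapping.lookup c (x, y)] \<cdot>\<^bsub>M\<^esub> (x \<otimes>\<^bsub>M\<^esub> y))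
     (Poly_Mapping.keys c)) ` U)"

section \<open>Depth two, Frobenius and separable extensions\<close>

definition depth_two ::
    "('n, 'x) ring_scheme \<Rightarrow> ('m, 'y) ring_scheme \<Rightarrow> ('n \<Rightarrow> 'm) \<Rightarrow> bool" where
  "depth_two N M \<eta> \<longleftrightarrow>
     (\<exists>n\<ge>1. iso_direct_summand N M (restrict_scalars \<eta> (\<lambda>m. m) (tensor_square N M \<eta>))
        (direct_power n (as_NM M \<eta>))) \<and>
     (\<exists>n\<ge>1. iso_direct_summand M N (restrict_scalars (\<lambda>m. m) \<eta> (tensor_square N M \<eta>))
        (direct_power n (as_MN M \<eta>)))"

definition frobenius_extension ::
    "('n, 'x) ring_scheme \<Rightarrow> ('m, 'y) ring_scheme \<Rightarrow> ('n \<Rightarrow> 'm) \<Rightarrow> bool" where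
  "frobenius_extension N M \<eta> \<longleftrightarrow>
     (\<exists>E \<in> bimodule_hom N N (restrict_scalars \<eta> \<eta> (regular_bimodule M)) (regular_bimodule N).
      \<exists>(r::nat) x y. x \<in> {..<r} \<rightarrow> carrier M \<and> y \<in> {..<r} \<rightarrow> carrier M \<and>
        (\<forall>m \<in> carrier M.
           finsum M (\<lambda>i. x i \<otimes>\<^bsub>M\<^esub> \<eta> (E (y i \<otimes>\<^bsub>M\<^esub> m))) {..<r} = m \<and>
           finsum M (\<lambda>i. \<eta> (E (m \<otimes>\<^bsub>M\<^esub> x i)) \<otimes>\<^bsub>M\<^esub> y i) {..<r} = m))"

definition separable_extension ::
    "('n, 'x) ring_scheme \<Rightarrow> ('m, 'y) ring_scheme \<Rightarrow> ('n \<Rightarrow> 'm) \<Rightarrow> bool" where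
  "separable_extension N M \<eta> \<longleftrightarrow>
     split_bimodule_epi M M (tensor_square N M \<eta>) (regular_bimodule M) (mult_map M)"

text \<open>A separable \<open>K\<close>-algebra \<open>A\<close> is one for which \<open>K \<rightarrow> A\<close>, \<open>k \<mapsto> k1\<close>, is a separable extension.\<close>

definition separable_algebra ::
    "('k, 'x) ring_scheme \<Rightarrow> ('k, 'a, 'y) module_scheme \<Rightarrow> bool" where
  "separable_algebra K A \<longleftrightarrow>
     assoc_algebra K A \<and> separable_extension K A (\<lambda>k. k \<odot>\<^bsub>A\<^esub> \<one>\<^bsub>A\<^esub>)"

section \<open>The algebra \<open>(M \<otimes>\<^sub>N M)\<^sup>N\<close>\<close>

text \<open>On formal sums, \<open>casimir_mult M b b'\<close> extends \<open>(x, y), (x', y') \<mapsto> (x'x, yy')\<close> biadditively. It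
  does not descend to all of \<open>M \<otimes>\<^sub>N M\<close>, but it does so on the \<open>N\<close>-central elements: the
  formal products of all representatives then lie in a single coset.\<close>

definition casimir_mult ::
    "('m, 'y) ring_scheme \<Rightarrow> ('m \<times> 'm \<Rightarrow>\<^sub>0 int) \<Rightarrow> ('m \<times> 'm \<Rightarrow>\<^sub>0 int) \<Rightarrow>
     ('m \<times> 'm \<Rightarrow>\<^sub>0 int)" where
  "casimir_mult M b b' = frag_extend (\<lambda>(x, y).
     frag_extend (\<lambda>(x', y'). frag_of (x' \<otimes>\<^bsub>M\<^esub> x, y \<otimes>\<^bsub>M\<^esub> y')) b') b"

definition casimir_algebra ::
    "('n, 'x) ring_scheme \<Rightarrow> ('k, 'm, 'y) module_scheme \<Rightarrow> ('n \<Rightarrow> 'm) \<Rightarrow>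
     ('k, ('m \<times> 'm \<Rightarrow>\<^sub>0 int) set) module" where
  "casimir_algebra N M \<eta> =
    (let T = tensor_square N M \<eta>;
         F = tensor_free (as_MN M \<eta>) (as_NM M \<eta>);
         H = tensor_rel N (as_MN M \<eta>) (as_NM M \<eta>)
     in \<lparr>carrier = {b \<in> carrier T. \<forall>n \<in> carrier N. lact T (\<eta> n) b = ract T b (\<eta> n)},
         monoid.mult = (\<lambda>b b'. H <#>\<^bsub>F\<^esub> {casimir_mult M c c' | c c'. c \<in> b \<and> c' \<in> b'}),
         monoid.one = H #>\<^bsub>F\<^esub> frag_of (\<one>\<^bsub>M\<^esub>, \<one>\<^bsub>M\<^esub>),
         ring.zero = ring.zero T, ring.add = ring.add T,
         smult = (\<lambda>k b. lact T (k \<odot>\<^bsub>M\<^esub> \<one>\<^bsub>M\<^esub>) b)\<rparr>)"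

end

theory Submission
  imports Defs
begin

text \<open>Write \<open>T = M \<otimes>\<^sub>N M\<close> and \<open>B = T\<^sup>N\<close>. Depth two, for \<open>M\<close>-\<open>N\<close>-bimodules, gives finitely many
  \<open>M\<close>-\<open>N\<close>-bimodule maps \<open>f\<^sub>k : T \<rightarrow> M\<close> and \<open>b\<^sub>k \<in> B\<close> with \<open>t = \<Sum>\<^sub>k f\<^sub>k(t) b\<^sub>k\<close> for all \<open>t \<in> T\<close>.
  By irreducibility \<open>b \<mapsto> b\<^sup>1b\<^sup>2\<close> is a character \<open>\<epsilon>\<close> of \<open>B\<close> with values in \<open>K\<close>, and each \<open>f\<^sub>k\<close> maps \<open>B\<close> to \<open>K\<close>.

  If \<open>u\<close> is a separability element of \<open>B\<close>, then \<open>t = \<epsilon>(u\<^sup>1)u\<^sup>2\<close> satisfies \<open>tb = \<epsilon>(b)t\<close> and \<open>\<epsilon>(t) = 1\<close>. Since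
  \<open>1 \<otimes> m = \<Sum>\<^sub>k f\<^sub>k(1 \<otimes> m) b\<^sub>k\<close>, the element \<open>tm = \<Sum>\<^sub>k f\<^sub>k(1 \<otimes> m)(tb\<^sub>k)\<close> equals \<open>mt\<close>, so \<open>t\<close> is a
  separability element of \<open>M|N\<close>.

  If \<open>e\<close> is a separability element of \<open>M|N\<close>, then \<open>\<Sum>\<^sub>k b\<^sub>k \<otimes> (f\<^sub>k(1 \<otimes> e\<^sup>1) \<otimes> e\<^sup>2)\<close> is one of \<open>B\<close>: this is
  \<open>S(e\<^sub>1) \<otimes> e\<^sub>2\<close> for the coproduct \<open>b\<^sup>1 \<otimes> 1 \<otimes> b\<^sup>2\<close> and the antipode \<open>S(b) = \<Sum>\<^sub>k f\<^sub>k(1 \<otimes> b\<^sup>1)b\<^sup>2 b\<^sub>k\<close>.\<close>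

section \<open>Additive maps\<close>

abbreviation additive_maps where
  "additive_maps U V \<equiv> hom (add_monoid U) (add_monoid V)"

lemma additive_closed:
  "f \<in> additive_maps U V \<Longrightarrow> x \<in> carrier U \<Longrightarrow> f x \<in> carrier V"
  by (auto simp: hom_def)

lemma additive_add:
  "f \<in> additive_maps U V \<Longrightarrow> x \<in> carrier U \<Longrightarrow> y \<in> carrier U \<Longrightarrow> f (x \<oplus>\<^bsub>U\<^esub> y) = f x \<oplus>\<^bsub>V\<^esub> f y"
  by (auto simp: hom_def)

lemma additiveI:
  assumes "\<And>x. x \<in> carrier U \<Longrightarrow> f x \<in> carrier V"
    and "\<And>x y. x \<in> carrier U \<Longrightarrow> y \<in> carrier U \<Longrightarrow> f (x \<oplus>\<^bsub>U\<^esub> y) = f x \<oplus>\<^bsub>V\<^esub> f y"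
  shows "f \<in> additive_maps U V"
  using assms by (auto simp: hom_def)

lemma additive_zero:
  assumes "abelian_group U" "abelian_group V" "f \<in> additive_maps U V"
  shows "f \<zero>\<^bsub>U\<^esub> = \<zero>\<^bsub>V\<^esub>"
  using hom_one[OF assms(3)] assms(1,2) by (simp add: abelian_group.a_group)

lemma additive_finsum:
  assumes "abelian_group U" "abelian_group V" "f \<in> additive_maps U V"
    and "finite I" "\<And>i. i \<in> I \<Longrightarrow> g i \<in> carrier U"
  shows "f (finsum U g I) = finsum V (\<lambda>i. f (g i)) I"
proof -
  interpret U: abelian_group U by fact
  interpret V: abelian_group V by fact
  show ?thesis using assms(4,5)
  proof (induction I rule: finite_induct)
    case empty
    then show ?case using additive_zero[OF assms(1-3)] by simp
  next
    case (insert i I)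
    then have "g \<in> I \<rightarrow> carrier U" "(\<lambda>i. f (g i)) \<in> I \<rightarrow> carrier V"
      by (auto intro: additive_closed[OF assms(3)])
    then show ?case using insert
      by (simp add: additive_add[OF assms(3)] additive_closed[OF assms(3)])
  qed
qed

text \<open>Serves uniqueness in a direct sum: two decompositions of one element produce an element
  lying in both summands.\<close>

lemma (in abelian_group) diff_eq_diffI:
  assumes "a \<oplus> w = b \<oplus> w'" "a \<in> carrier G" "w \<in> carrier G" "b \<in> carrier G" "w' \<in> carrier G"
  shows "a \<ominus> b = w' \<ominus> w"
proof -
  have "a \<ominus> b = ((a \<oplus> w) \<oplus> \<ominus> w) \<oplus> \<ominus> b"
    using assms(2-5) by (simp add: minus_eq a_assoc r_neg)
  also have "\<dots> = b \<oplus> (\<ominus> b \<oplus> (w' \<oplus> \<ominus> w))"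
    unfolding assms(1) using assms(2-5) by (simp add: a_ac)
  also have "\<dots> = w' \<ominus> w" using assms(2-5) by (simp add: r_neg2 minus_eq)
  finally show ?thesis .
qed

lemma additive_minus:
  assumes "abelian_group U" "abelian_group V" "f \<in> additive_maps U V" "x \<in> carrier U" "y \<in> carrier U"
  shows "f (x \<ominus>\<^bsub>U\<^esub> y) = f x \<ominus>\<^bsub>V\<^esub> f y"
proof -
  interpret U: abelian_group U by fact
  interpret V: abelian_group V by fact
  note cl = additive_closed[OF assms(3)]
  have "f (\<ominus>\<^bsub>U\<^esub> y) \<oplus>\<^bsub>V\<^esub> f y = f (\<ominus>\<^bsub>U\<^esub> y \<oplus>\<^bsub>U\<^esub> y)"
    using assms(5) by (simp add: additive_add[OF assms(3)])
  also have "\<dots> = \<zero>\<^bsub>V\<^esub>" using assms(5) additive_zero[OF assms(1-3)] by (simp add: U.l_neg)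
  finally have "\<ominus>\<^bsub>V\<^esub> f y = f (\<ominus>\<^bsub>U\<^esub> y)"
    using cl assms(5) by (intro V.minus_equality) auto
  then show ?thesis using assms(4,5) by (simp add: U.minus_eq V.minus_eq additive_add[OF assms(3)])
qed

lemma abelian_group_finsum_swap:
  assumes "abelian_group G" "finite I" "finite J"
    and "\<And>i j. i \<in> I \<Longrightarrow> j \<in> J \<Longrightarrow> g i j \<in> carrier G"
  shows "finsum G (\<lambda>i. finsum G (g i) J) I = finsum G (\<lambda>j. finsum G (\<lambda>i. g i j) I) J"
proof -
  interpret G: abelian_group G by fact
  show ?thesis using assms(2,4)
  proof (induction I rule: finite_induct)
    case empty
    then show ?case by (simp add: G.finsum_zero)
  next
    case (insert i I)
    have c: "g i j \<in> carrier G" "finsum G (\<lambda>i. g i j) I \<in> carrier G" if "j \<in> J" for j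
      using insert.prems that by auto
    have "finsum G (\<lambda>i. finsum G (g i) J) (insert i I)
        = finsum G (g i) J \<oplus>\<^bsub>G\<^esub> finsum G (\<lambda>i. finsum G (g i) J) I"
      using insert.hyps insert.prems by (intro G.finsum_insert) auto
    also have "\<dots> = finsum G (\<lambda>j. g i j \<oplus>\<^bsub>G\<^esub> finsum G (\<lambda>i. g i j) I) J"
      using insert.IH insert.prems c by (subst G.finsum_addf) auto
    also have "\<dots> = finsum G (\<lambda>j. finsum G (\<lambda>i. g i j) (insert i I)) J"
      using insert.hyps insert.prems c by (intro G.finsum_cong') auto
    finally show ?case .
  qed
qed

section \<open>The tensor square of a ring extension\<close>

text \<open>No base ring occurs here, so that the same theory applies twice: to
  \<open>\<eta>\<close> from \<open>N\<close> to \<open>M\<close>, and to the unit map from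
  \<open>K\<close> to the algebra of Casimir elements.\<close>

locale ring_extension = N: ring N + M: ring M
  for N :: "('n, 'x) ring_scheme" and M :: "('m, 'y) ring_scheme" and \<eta> +
  assumes eta: "\<eta> \<in> ring_hom N M"
begin

section \<open>Pure tensors in the quotient group\<close>

abbreviation "T \<equiv> tensor_square N M \<eta>"
abbreviation "F \<equiv> free_Abelian_group (carrier M \<times> carrier M)"
abbreviation "H \<equiv> tensor_rel N (as_MN M \<eta>) (as_NM M \<eta>)"

text \<open>The generators of \<open>H\<close> with all record operations evaluated;
  \<open>H_eq\<close> links them to \<open>tensor_rel\<close>, and descent arguments split into
  these three cases.\<close>

definition relators where
  "relators = {frag_of (x \<oplus>\<^bsub>M\<^esub> x', y) - frag_of (x, y) - frag_of (x', y) | x x' y.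
         x \<in> carrier M \<and> x' \<in> carrier M \<and> y \<in> carrier M} \<union>
      {frag_of (x, y \<oplus>\<^bsub>M\<^esub> y') - frag_of (x, y) - frag_of (x, y') | x y y'.
         x \<in> carrier M \<and> y \<in> carrier M \<and> y' \<in> carrier M} \<union>
      {frag_of (x \<otimes>\<^bsub>M\<^esub> \<eta> n, y) - frag_of (x, \<eta> n \<otimes>\<^bsub>M\<^esub> y) | x n y.
         x \<in> carrier M \<and> n \<in> carrier N \<and> y \<in> carrier M}"

lemma relators_intros:
  "\<lbrakk>x \<in> carrier M; x' \<in> carrier M; y \<in> carrier M\<rbrakk> \<Longrightarrow>
    frag_of (x \<oplus>\<^bsub>M\<^esub> x', y) - frag_of (x, y) - frag_of (x', y) \<in> relators"
  "\<lbrakk>x \<in> carrier M; y \<in> carrier M; y' \<in> carrier M\<rbrakk> \<Longrightarrow>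
    frag_of (x, y \<oplus>\<^bsub>M\<^esub> y') - frag_of (x, y) - frag_of (x, y') \<in> relators"
  "\<lbrakk>x \<in> carrier M; n \<in> carrier N; y \<in> carrier M\<rbrakk> \<Longrightarrow>
    frag_of (x \<otimes>\<^bsub>M\<^esub> \<eta> n, y) - frag_of (x, \<eta> n \<otimes>\<^bsub>M\<^esub> y) \<in> relators"
  unfolding relators_def
    apply (rule UnI1, rule UnI1, rule CollectI, rule exI[of _ x], rule exI[of _ x'], rule exI[of _ y], simp)
   apply (rule UnI1, rule UnI2, rule CollectI, rule exI[of _ x], rule exI[of _ y], rule exI[of _ y'], simp)
  apply (rule UnI2, rule CollectI, rule exI[of _ x], rule exI[of _ n], rule exI[of _ y], simp)
  done

lemma eta_closed [simp, intro]: "n \<in> carrier N \<Longrightarrow> \<eta> n \<in> carrier M"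
  using eta by (auto simp: ring_hom_def)

lemma F_eq: "tensor_free (as_MN M \<eta>) (as_NM M \<eta>) = F"
  by (simp add: restrict_scalars_def regular_bimodule_def)

lemma H_eq: "H = generate F relators"
  by (simp add: tensor_rel_def relators_def restrict_scalars_def regular_bimodule_def)

sublocale F: comm_group F
  by (rule abelian_free_Abelian_group)

lemma keys_diff_subset:
  assumes "Poly_Mapping.keys a \<subseteq> S" "Poly_Mapping.keys b \<subseteq> S"
  shows "Poly_Mapping.keys (a - b) \<subseteq> S"
  using keys_diff[of a b] assms by blast

lemma frag_add_F:
  "x \<in> carrier F \<Longrightarrow> y \<in> carrier F \<Longrightarrow> x + y \<in> carrier F"
  using F.m_closed[of x y] by simp

lemma relators_F: "relators \<subseteq> carrier F"
proof
  fix r assume "r \<in> relators"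
  then show "r \<in> carrier F"
    unfolding relators_def by (elim UnE CollectE exE conjE) (simp_all add: keys_diff_subset)
qed

lemma H_normal: "H \<lhd> F"
  unfolding H_eq using F.generate_is_subgroup[OF relators_F] F.normal_iff_subgroup by simp

sublocale H: normal H F
  by (rule H_normal)

definition cls where "cls c = H #>\<^bsub>F\<^esub> c"

definition tens where "tens x y = cls (frag_of (x, y))"

text \<open>Right cosets with the set product form the quotient group \<open>F Mod H\<close>, so its
  group laws and the factorisation of homomorphisms carry over.\<close>

lemma T_simps:
  "carrier T = carrier (F Mod H)" "x \<oplus>\<^bsub>T\<^esub> y = x \<otimes>\<^bsub>F Mod H\<^esub> y" "\<zero>\<^bsub>T\<^esub> = \<one>\<^bsub>F Mod H\<^esub>"
  by (simp_all add: tensor_square_def tensor_product_def FactGroup_def F_eq)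

lemma additive_T: "additive_maps T G = hom (F Mod H) (add_monoid G)"
  by (simp add: hom_def T_simps)

lemma abelian_group_T: "abelian_group T"
proof -
  interpret Q: comm_group "F Mod H"
    by (rule F.abelian_FactGroup[OF H.subgroup_axioms])
  show ?thesis
  proof (rule abelian_groupI)
    show "\<exists>y \<in> carrier T. y \<oplus>\<^bsub>T\<^esub> x = \<zero>\<^bsub>T\<^esub>" if "x \<in> carrier T" for x
      using that Q.l_inv Q.inv_closed unfolding T_simps by blast
  qed (unfold T_simps; (rule Q.m_closed Q.one_closed Q.m_assoc Q.m_comm Q.l_one; assumption))+
qed

sublocale T: abelian_group T
  by (rule abelian_group_T)

lemma carrier_T: "carrier T = cls ` carrier F"
  by (simp add: T_simps carrier_FactGroup cls_def)

lemma cls_add: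
  assumes "c \<in> carrier F" "d \<in> carrier F"
  shows "cls (c + d) = cls c \<oplus>\<^bsub>T\<^esub> cls d"
  using H.rcos_sum[OF assms] by (simp add: cls_def T_simps)

lemma cls_hom: "cls \<in> hom F (add_monoid T)"
  by (rule homI) (auto simp: carrier_T cls_add)

lemma cls_eqI:
  assumes "c \<in> carrier F" "d \<in> carrier F" "c - d \<in> H"
  shows "cls c = cls d"
proof -
  have "c = (c - d) \<otimes>\<^bsub>F\<^esub> d" by simp
  then have "c \<in> H #>\<^bsub>F\<^esub> d" using assms(3) unfolding r_coset_def by blast
  then show ?thesis unfolding cls_def
    using F.repr_independence[OF _ assms(2) H.subgroup_axioms] by metis
qed

lemma cls_diff:
  assumes "c \<in> carrier F" "d \<in> carrier F"
  shows "cls (c - d) = cls c \<ominus>\<^bsub>T\<^esub> cls d"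
proof -
  have "c - d \<in> carrier F" using assms by (simp add: keys_diff_subset)
  then have "cls (c - d) \<oplus>\<^bsub>T\<^esub> cls d = cls c" "cls (c-d) \<in> carrier T" "cls d \<in> carrier T"
    using cls_add[of "c-d" d] assms by (auto simp: carrier_T simp del: carrier_free_Abelian_group_iff)
  then show ?thesis
    by (metis T.minus_eq assms(1) T.add.inv_solve_right carrier_T imageI)
qed

lemma H_relI: "r \<in> relators \<Longrightarrow> r \<in> H"
  unfolding H_eq by (rule generate.incl)

lemma tens_closed [simp, intro]: "x \<in> carrier M \<Longrightarrow> y \<in> carrier M \<Longrightarrow> tens x y \<in> carrier T"
  unfolding tens_def carrier_T by (rule imageI) simp

lemma tens_add_left:
  assumes "x \<in> carrier M" "x' \<in> carrier M" "y \<in> carrier M"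
  shows "tens (x \<oplus>\<^bsub>M\<^esub> x') y = tens x y \<oplus>\<^bsub>T\<^esub> tens x' y"
proof -
  have "tens (x \<oplus>\<^bsub>M\<^esub> x') y = cls (frag_of (x, y) + frag_of (x', y))"
    unfolding tens_def
  proof (rule cls_eqI)
    show "frag_of (x \<oplus>\<^bsub>M\<^esub> x', y) - (frag_of (x, y) + frag_of (x', y)) \<in> H"
      unfolding diff_diff_eq[symmetric] using assms by (intro H_relI relators_intros)
  qed (use assms in \<open>auto intro!: frag_add_F simp del: carrier_free_Abelian_group_iff\<close>)
  then show ?thesis
    using assms by (simp add: cls_add tens_def)
qed

lemma tens_add_right:
  assumes "x \<in> carrier M" "y \<in> carrier M" "y' \<in> carrier M"
  shows "tens x (y \<oplus>\<^bsub>M\<^esub> y') = tens x y \<oplus>\<^bsub>T\<^esub> tens x y'"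
proof -
  have "tens x (y \<oplus>\<^bsub>M\<^esub> y') = cls (frag_of (x, y) + frag_of (x, y'))"
    unfolding tens_def
  proof (rule cls_eqI)
    show "frag_of (x, y \<oplus>\<^bsub>M\<^esub> y') - (frag_of (x, y) + frag_of (x, y')) \<in> H"
      unfolding diff_diff_eq[symmetric] using assms by (intro H_relI relators_intros)
  qed (use assms in \<open>auto intro!: frag_add_F simp del: carrier_free_Abelian_group_iff\<close>)
  then show ?thesis
    using assms by (simp add: cls_add tens_def)
qed

lemma tens_balanced:
  assumes "x \<in> carrier M" "n \<in> carrier N" "y \<in> carrier M"
  shows "tens (x \<otimes>\<^bsub>M\<^esub> \<eta> n) y = tens x (\<eta> n \<otimes>\<^bsub>M\<^esub> y)"
  unfolding tens_def
proof (rule cls_eqI)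
  show "frag_of (x \<otimes>\<^bsub>M\<^esub> \<eta> n, y) - frag_of (x, \<eta> n \<otimes>\<^bsub>M\<^esub> y) \<in> H"
    using assms by (intro H_relI relators_intros)
qed (use assms in auto)

lemma tens_zero_left: "y \<in> carrier M \<Longrightarrow> tens \<zero>\<^bsub>M\<^esub> y = \<zero>\<^bsub>T\<^esub>"
  using tens_add_left[of "\<zero>\<^bsub>M\<^esub>" "\<zero>\<^bsub>M\<^esub>" y]
  by (simp add: T.add.l_cancel_one' eq_commute[of "tens _ _"])

lemma tens_minus_left:
  assumes "x \<in> carrier M" "y \<in> carrier M"
  shows "tens (\<ominus>\<^bsub>M\<^esub> x) y = \<ominus>\<^bsub>T\<^esub> tens x y"
  by (rule T.minus_equality[symmetric])
    (use tens_add_left[of "\<ominus>\<^bsub>M\<^esub> x" x y] assms in \<open>simp_all add: M.l_neg tens_zero_left\<close>)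

text \<open>Zero and negatives have no cases of their own because they are pure tensors or sums of
  such: 0 is 0 \<otimes> 0, and -(x \<otimes> y) is (-x) \<otimes> y.\<close>

lemma tensor_induct [consumes 1, case_names tens add]:
  assumes t: "t \<in> carrier T"
    and tens: "\<And>x y. x \<in> carrier M \<Longrightarrow> y \<in> carrier M \<Longrightarrow> P (tens x y)"
    and add: "\<And>u v. u \<in> carrier T \<Longrightarrow> v \<in> carrier T \<Longrightarrow> P u \<Longrightarrow> P v \<Longrightarrow> P (u \<oplus>\<^bsub>T\<^esub> v)"
  shows "P t"
proof -
  obtain c where c: "c \<in> carrier F" "t = cls c" using t by (auto simp: carrier_T)
  \<comment> \<open>Induction over the free group builds differences, so \<open>P\<close> is carried
    along for the negative as well; a difference is then a sum of two known cases.\<close>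
  have "P (cls c) \<and> P (\<ominus>\<^bsub>T\<^esub> cls c)"
  proof (rule free_Abelian_group_induct[OF c(1)[simplified],
        where P = "\<lambda>c. P (cls c) \<and> P (\<ominus>\<^bsub>T\<^esub> cls c)"], goal_cases)
    case 1
    have "cls 0 = \<zero>\<^bsub>T\<^esub>"
      using hom_one[OF cls_hom] T.a_group by simp
    then show ?case using tens[of "\<zero>\<^bsub>M\<^esub>" "\<zero>\<^bsub>M\<^esub>"] by (simp add: tens_zero_left T.minus_equality[of "\<zero>\<^bsub>T\<^esub>" "\<zero>\<^bsub>T\<^esub>"])
  next
    case (2 c d)
    then have cl: "cls c \<in> carrier T" "cls d \<in> carrier T" by (auto simp: carrier_T)
    have "\<ominus>\<^bsub>T\<^esub> (cls c \<ominus>\<^bsub>T\<^esub> cls d) = \<ominus>\<^bsub>T\<^esub> cls c \<oplus>\<^bsub>T\<^esub> cls d"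
      using cl by (simp add: T.minus_eq T.minus_add)
    then show ?case using 2 cl add[of "cls c" "\<ominus>\<^bsub>T\<^esub> cls d"] add[of "\<ominus>\<^bsub>T\<^esub> cls c" "cls d"]
      by (simp add: cls_diff T.minus_eq)
  next
    case (3 a)
    then obtain x y where a: "a = (x, y)" "x \<in> carrier M" "y \<in> carrier M" by auto
    then show ?case using tens[of x y] tens[of "\<ominus>\<^bsub>M\<^esub> x" y]
      by (simp add: tens_minus_left flip: tens_def)
  qed
  then show ?thesis using c by simp
qed

section \<open>Universal property of the tensor square\<close>

definition balanced where
  "balanced G \<phi> \<longleftrightarrow>
    (\<forall>x \<in> carrier M. \<forall>y \<in> carrier M. \<phi> x y \<in> carrier G) \<and>
    (\<forall>x \<in> carrier M. \<forall>x' \<in> carrier M. \<forall>y \<in> carrier M. \<phi> (x \<oplus>\<^bsub>M\<^esub> x') y = \<phi> x y \<oplus>\<^bsub>G\<^esub> \<phi> x' y) \<and>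
    (\<forall>x \<in> carrier M. \<forall>y \<in> carrier M. \<forall>y' \<in> carrier M. \<phi> x (y \<oplus>\<^bsub>M\<^esub> y') = \<phi> x y \<oplus>\<^bsub>G\<^esub> \<phi> x y') \<and>
    (\<forall>x \<in> carrier M. \<forall>n \<in> carrier N. \<forall>y \<in> carrier M. \<phi> (x \<otimes>\<^bsub>M\<^esub> \<eta> n) y = \<phi> x (\<eta> n \<otimes>\<^bsub>M\<^esub> y))"

text \<open>For balanced \<open>\<phi>\<close> into an abelian group the map exists by
  \<open>lift_exists\<close> and is unique on \<open>carrier T\<close>, which the pure tensors
  generate; \<open>SOME\<close> only fixes values elsewhere.\<close>

definition lift where
  "lift G \<phi> = (SOME h. h \<in> additive_maps T G \<and>
     (\<forall>x \<in> carrier M. \<forall>y \<in> carrier M. h (tens x y) = \<phi> x y))"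

lemma hom_F_diff:
  assumes "comm_group G" "h \<in> hom F G" "c \<in> carrier F" "d \<in> carrier F"
  shows "h (c - d) = h c \<otimes>\<^bsub>G\<^esub> inv\<^bsub>G\<^esub> h d"
proof -
  interpret G: comm_group G by fact
  have "c - d \<in> carrier F" using assms by (simp add: keys_diff_subset)
  then have "h (c - d) \<otimes>\<^bsub>G\<^esub> h d = h c" "h (c - d) \<in> carrier G" "h c \<in> carrier G" "h d \<in> carrier G"
    using hom_mult[OF assms(2), of "c - d" d] assms hom_in_carrier[OF assms(2)] by auto
  then show ?thesis using G.inv_solve_right[of "h (c - d)" "h c" "h d"] by simp
qed

text \<open>The function extends from basis pairs to the free group; biadditivity and balancing kill
  the relators, so the extension factors through the quotient by \<open>H\<close>.\<close>

lemma lift_exists: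
  assumes G: "abelian_group G" and \<phi>: "balanced G \<phi>"
  shows "\<exists>h. h \<in> additive_maps T G \<and> (\<forall>x \<in> carrier M. \<forall>y \<in> carrier M. h (tens x y) = \<phi> x y)"
proof -
  interpret G: abelian_group G by fact
  have "(\<lambda>(x, y). \<phi> x y) ` (carrier M \<times> carrier M) \<subseteq> carrier (add_monoid G)"
    using \<phi> by (auto simp: balanced_def)
  then obtain h where h: "h \<in> hom F (add_monoid G)"
    and h_of: "\<And>p. p \<in> carrier M \<times> carrier M \<Longrightarrow> h (frag_of p) = (case p of (x, y) \<Rightarrow> \<phi> x y)"
    by (rule comm_group.free_Abelian_group_universal[OF G.a_comm_group]) blast+
  interpret h: group_hom F "add_monoid G" h
    using h by unfold_locales
  have diff: "h (c - d) = h c \<ominus>\<^bsub>G\<^esub> h d" if "c \<in> carrier F" "d \<in> carrier F" for c d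
    using hom_F_diff[OF G.a_comm_group h that] by (simp add: a_inv_def a_minus_def)
  have "relators \<subseteq> kernel F (add_monoid G) h"
  proof
    fix r assume r: "r \<in> relators"
    then have "h r = \<zero>\<^bsub>G\<^esub>"
      unfolding relators_def
    proof (elim UnE CollectE exE conjE, goal_cases)
      case (1 x x' y)
      then show ?case using \<phi>
        by (simp add: diff h_of keys_diff_subset balanced_def G.minus_eq G.a_assoc G.a_lcomm G.r_neg G.r_neg2)
    next
      case (2 x y y')
      then show ?case using \<phi>
        by (simp add: diff h_of keys_diff_subset balanced_def G.minus_eq G.a_assoc G.a_lcomm G.r_neg G.r_neg2)
    next
      case (3 x n y)
      then show ?case using \<phi>
        by (simp add: diff h_of keys_diff_subset balanced_def G.minus_eq G.r_neg)
    qed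
    then show "r \<in> kernel F (add_monoid G) h"
      using subsetD[OF relators_F r] by (simp add: kernel_def)
  qed
  \<comment> \<open>A kernel is a subgroup, so killing the generators of \<open>H\<close>
    suffices.\<close>
  then have "H \<subseteq> kernel F (add_monoid G) h"
    unfolding H_eq by (rule F.generate_subgroup_incl[OF _ h.subgroup_kernel])
  then obtain g where g: "g \<in> hom (F Mod H) (add_monoid G)" "\<And>c. c \<in> carrier F \<Longrightarrow> g (H #>\<^bsub>F\<^esub> c) = h c"
    using h.FactGroup_universal_kernel[OF H_normal] by blast
  show ?thesis
  proof (intro exI conjI ballI)
    show "g \<in> additive_maps T G" using g(1) by (simp add: additive_T)
    show "g (tens x y) = \<phi> x y" if "x \<in> carrier M" "y \<in> carrier M" for x y
      using that g(2) by (simp add: tens_def cls_def h_of)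
  qed
qed

lemma lift_spec:
  assumes "abelian_group G" "balanced G \<phi>"
  shows "lift G \<phi> \<in> additive_maps T G \<and>
    (\<forall>x \<in> carrier M. \<forall>y \<in> carrier M. lift G \<phi> (tens x y) = \<phi> x y)"
  unfolding lift_def by (rule someI_ex[OF lift_exists[OF assms]])

lemmas lift_additive = lift_spec[THEN conjunct1]
  and lift_tens = lift_spec[THEN conjunct2, THEN bspec, THEN bspec]

section \<open>The outer actions on the tensor square\<close>

text \<open>An additive map sending the generators of \<open>H\<close> into \<open>H\<close>
  preserves \<open>H\<close> and so acts on cosets. Adding \<open>H\<close> fills the image of a
  coset up to a full coset, which is the form of the actions in
  \<open>tensor_product\<close>.\<close>

lemma coset_map:
  assumes add: "\<And>c d. g (c + d) = g c + g d" and closed: "\<And>c. c \<in> carrier F \<Longrightarrow> g c \<in> carrier F"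
    and rel: "\<And>r. r \<in> relators \<Longrightarrow> g r \<in> H" and c: "c \<in> carrier F"
  shows "H <#>\<^bsub>F\<^esub> g ` cls c = cls (g c)"
proof -
  have g0: "g 0 = 0"
  proof -
    have "g 0 + g 0 = g 0 + 0" unfolding add[symmetric] by simp
    then show ?thesis by (rule add_left_imp_eq)
  qed
  have g_minus: "g (- h) = - g h" for h
  proof -
    have "g h + g (- h) = 0" unfolding add[symmetric] by (simp add: g0)
    then show ?thesis by (simp add: eq_neg_iff_add_eq_0 add.commute)
  qed
  have gH: "g h \<in> H" if "h \<in> H" for h
    using that[unfolded H_eq]
  proof (induction rule: generate.induct)
    case one
    then show ?case using H.one_closed by (simp add: g0)
  next
    case (incl r)
    then show ?case by (rule rel)
  next
    case (inv r)
    then have "r \<in> carrier F" using relators_F by blast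
    moreover have "g r \<in> carrier F" using rel[OF inv] H.subset by blast
    ultimately show ?case using H.m_inv_closed[OF rel[OF inv]] by (simp add: g_minus)
  next
    case (eng a b)
    then show ?case using H.m_closed[of "g a" "g b"] by (simp add: add)
  qed
  show ?thesis
  proof
    show "H <#>\<^bsub>F\<^esub> g ` cls c \<subseteq> cls (g c)"
    proof
      fix u assume "u \<in> H <#>\<^bsub>F\<^esub> g ` cls c"
      then obtain h h' where "h \<in> H" "h' \<in> H" "u = (h + g h') + g c"
        by (auto simp: set_mult_def cls_def r_coset_def add add.assoc[symmetric])
      then show "u \<in> cls (g c)"
        using H.m_closed[of h "g h'"] gH[of h'] by (auto simp: cls_def r_coset_def)
    qed
    show "cls (g c) \<subseteq> H <#>\<^bsub>F\<^esub> g ` cls c"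
    proof
      fix u assume "u \<in> cls (g c)"
      then obtain h where h: "h \<in> H" "u = h \<otimes>\<^bsub>F\<^esub> g c" by (auto simp: cls_def r_coset_def)
      moreover have "c \<in> cls c" unfolding cls_def by (rule F.rcos_self[OF c H.subgroup_axioms])
      ultimately show "u \<in> H <#>\<^bsub>F\<^esub> g ` cls c" unfolding set_mult_def by blast
    qed
  qed
qed

lemma frag_extend_closed:
  assumes "c \<in> carrier F" "\<And>x y. x \<in> carrier M \<Longrightarrow> y \<in> carrier M \<Longrightarrow> f (x, y) \<in> carrier F"
  shows "frag_extend f c \<in> carrier F"
proof -
  have "Poly_Mapping.keys (f a) \<subseteq> carrier M \<times> carrier M" if "a \<in> Poly_Mapping.keys c" for a
  proof -
    have "a \<in> carrier M \<times> carrier M" using that assms(1) by auto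
    then show ?thesis using assms(2)[of "fst a" "snd a"] by (simp add: mem_Times_iff)
  qed
  then show ?thesis
    unfolding carrier_free_Abelian_group_iff by (rule order_trans[OF keys_frag_extend UN_least])
qed

lemma lact_cls:
  assumes "p \<in> carrier M" "c \<in> carrier F"
  shows "lact T p (cls c) = cls (frag_extend (\<lambda>(x, y). frag_of (p \<otimes>\<^bsub>M\<^esub> x, y)) c)"
proof -
  have "lact T p (cls c) = H <#>\<^bsub>F\<^esub> frag_extend (\<lambda>(x, y). frag_of (p \<otimes>\<^bsub>M\<^esub> x, y)) ` cls c"
    by (simp add: tensor_square_def tensor_product_def restrict_scalars_def regular_bimodule_def)
  also have "\<dots> = cls (frag_extend (\<lambda>(x, y). frag_of (p \<otimes>\<^bsub>M\<^esub> x, y)) c)"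
  proof (rule coset_map)
    fix r assume "r \<in> relators"
    then show "frag_extend (\<lambda>(x, y). frag_of (p \<otimes>\<^bsub>M\<^esub> x, y)) r \<in> H"
      unfolding relators_def
    proof (elim UnE CollectE exE conjE, goal_cases)
      case (1 x x' y)
      then show ?case using assms
        by (simp add: frag_extend_diff M.r_distr H_relI relators_intros)
    next
      case (2 x y y')
      then show ?case using assms
        by (simp add: frag_extend_diff H_relI relators_intros)
    next
      case (3 x n y)
      then show ?case using assms
        using H_relI[OF relators_intros(3), of "p \<otimes>\<^bsub>M\<^esub> x" n y]
        by (simp add: frag_extend_diff M.m_assoc)
    qed
  qed (use assms in \<open>auto intro!: frag_extend_closed simp: frag_extend_add simp del: carrier_free_Abelian_group_iff\<close>)
  finally show ?thesis .
qed

lemma ract_cls: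
  assumes "q \<in> carrier M" "c \<in> carrier F"
  shows "ract T (cls c) q = cls (frag_extend (\<lambda>(x, y). frag_of (x, y \<otimes>\<^bsub>M\<^esub> q)) c)"
proof -
  have "ract T (cls c) q = H <#>\<^bsub>F\<^esub> frag_extend (\<lambda>(x, y). frag_of (x, y \<otimes>\<^bsub>M\<^esub> q)) ` cls c"
    by (simp add: tensor_square_def tensor_product_def restrict_scalars_def regular_bimodule_def)
  also have "\<dots> = cls (frag_extend (\<lambda>(x, y). frag_of (x, y \<otimes>\<^bsub>M\<^esub> q)) c)"
  proof (rule coset_map)
    fix r assume "r \<in> relators"
    then show "frag_extend (\<lambda>(x, y). frag_of (x, y \<otimes>\<^bsub>M\<^esub> q)) r \<in> H"
      unfolding relators_def
    proof (elim UnE CollectE exE conjE, goal_cases)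
      case (1 x x' y)
      then show ?case using assms
        by (simp add: frag_extend_diff H_relI relators_intros)
    next
      case (2 x y y')
      then show ?case using assms
        by (simp add: frag_extend_diff M.l_distr H_relI relators_intros)
    next
      case (3 x n y)
      then show ?case using assms
        by (simp add: frag_extend_diff M.m_assoc H_relI relators_intros)
    qed
  qed (use assms in \<open>auto intro!: frag_extend_closed simp: frag_extend_add simp del: carrier_free_Abelian_group_iff\<close>)
  finally show ?thesis .
qed

lemma lact_tens:
  "\<lbrakk>p \<in> carrier M; x \<in> carrier M; y \<in> carrier M\<rbrakk> \<Longrightarrow> lact T p (tens x y) = tens (p \<otimes>\<^bsub>M\<^esub> x) y"
  by (simp add: tens_def lact_cls)

lemma ract_tens:
  "\<lbrakk>q \<in> carrier M; x \<in> carrier M; y \<in> carrier M\<rbrakk> \<Longrightarrow> ract T (tens x y) q = tens x (y \<otimes>\<^bsub>M\<^esub> q)"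
  by (simp add: tens_def ract_cls)

lemma lact_additive: "p \<in> carrier M \<Longrightarrow> lact T p \<in> additive_maps T T"
proof (rule additiveI)
  fix s assume p: "p \<in> carrier M" and "s \<in> carrier T"
  then obtain c where c: "c \<in> carrier F" "s = cls c" by (auto simp: carrier_T)
  then show "lact T p s \<in> carrier T"
    using p by (auto intro!: imageI frag_extend_closed simp: lact_cls carrier_T simp del: carrier_free_Abelian_group_iff)
  fix t assume "t \<in> carrier T"
  then obtain d where "d \<in> carrier F" "t = cls d" by (auto simp: carrier_T)
  then show "lact T p (s \<oplus>\<^bsub>T\<^esub> t) = lact T p s \<oplus>\<^bsub>T\<^esub> lact T p t"
    using p c frag_extend_closed[where f = "\<lambda>(x, y). frag_of (p \<otimes>\<^bsub>M\<^esub> x, y)"]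
    by (simp add: lact_cls frag_add_F frag_extend_add cls_add[symmetric] del: carrier_free_Abelian_group_iff)
qed

lemma ract_additive: "q \<in> carrier M \<Longrightarrow> (\<lambda>t. ract T t q) \<in> additive_maps T T"
proof (rule additiveI)
  fix s assume q: "q \<in> carrier M" and "s \<in> carrier T"
  then obtain c where c: "c \<in> carrier F" "s = cls c" by (auto simp: carrier_T)
  then show "ract T s q \<in> carrier T"
    using q by (auto intro!: imageI frag_extend_closed simp: ract_cls carrier_T simp del: carrier_free_Abelian_group_iff)
  fix t assume "t \<in> carrier T"
  then obtain d where "d \<in> carrier F" "t = cls d" by (auto simp: carrier_T)
  then show "ract T (s \<oplus>\<^bsub>T\<^esub> t) q = ract T s q \<oplus>\<^bsub>T\<^esub> ract T t q"
    using q c frag_extend_closed[where f = "\<lambda>(x, y). frag_of (x, y \<otimes>\<^bsub>M\<^esub> q)"]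
    by (simp add: ract_cls frag_add_F frag_extend_add cls_add[symmetric] del: carrier_free_Abelian_group_iff)
qed

lemmas lact_closed [simp, intro] = additive_closed[OF lact_additive]
  and ract_closed [simp, intro] = additive_closed[OF ract_additive]
  and lact_add = additive_add[OF lact_additive]
  and ract_add = additive_add[OF ract_additive]

lemma lact_add_left:
  assumes "p \<in> carrier M" "q \<in> carrier M" "t \<in> carrier T"
  shows "lact T (p \<oplus>\<^bsub>M\<^esub> q) t = lact T p t \<oplus>\<^bsub>T\<^esub> lact T q t"
  using assms(3) by (induction rule: tensor_induct)
    (simp_all add: assms lact_tens lact_add M.l_distr tens_add_left T.a_ac)

lemma ract_add_right:
  assumes "p \<in> carrier M" "q \<in> carrier M" "t \<in> carrier T"
  shows "ract T t (p \<oplus>\<^bsub>M\<^esub> q) = ract T t p \<oplus>\<^bsub>T\<^esub> ract T t q"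
  using assms(3) by (induction rule: tensor_induct)
    (simp_all add: assms ract_tens ract_add M.r_distr tens_add_right T.a_ac)

lemma lact_mult:
  assumes "p \<in> carrier M" "q \<in> carrier M" "t \<in> carrier T"
  shows "lact T (p \<otimes>\<^bsub>M\<^esub> q) t = lact T p (lact T q t)"
  using assms(3) by (induction rule: tensor_induct)
    (simp_all add: assms lact_tens lact_add M.m_assoc)

lemma ract_mult:
  assumes "p \<in> carrier M" "q \<in> carrier M" "t \<in> carrier T"
  shows "ract T t (p \<otimes>\<^bsub>M\<^esub> q) = ract T (ract T t p) q"
  using assms(3) by (induction rule: tensor_induct)
    (simp_all add: assms ract_tens ract_add M.m_assoc)

lemma lact_ract:
  assumes "p \<in> carrier M" "q \<in> carrier M" "t \<in> carrier T"
  shows "lact T p (ract T t q) = ract T (lact T p t) q"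
  using assms(3) by (induction rule: tensor_induct)
    (simp_all add: assms lact_tens lact_add ract_tens ract_add)

lemma lact_one [simp]: "t \<in> carrier T \<Longrightarrow> lact T \<one>\<^bsub>M\<^esub> t = t"
  by (induction rule: tensor_induct) (simp_all add: lact_tens lact_add)

lemma ract_one [simp]: "t \<in> carrier T \<Longrightarrow> ract T t \<one>\<^bsub>M\<^esub> = t"
  by (induction rule: tensor_induct) (simp_all add: ract_tens ract_add)

section \<open>The multiplication map\<close>

text \<open>An element of the free group is the integer combination of its keys. This matches the
  sum over \<open>keys\<close> in \<open>mult_map\<close> with the value of a homomorphism.\<close>

lemma hom_F_expand:
  assumes G: "abelian_group G" and h: "h \<in> hom F (add_monoid G)" and c: "c \<in> carrier F"
  shows "h c = finsum G (\<lambda>a. [Poly_Mapping.lookup c a] \<cdot>\<^bsub>G\<^esub> h (frag_of a)) (Poly_Mapping.keys c)"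
proof -
  interpret G: abelian_group G by fact
  interpret h: group_hom F "add_monoid G" h
    using h by unfold_locales
  have h0: "h 0 = \<zero>\<^bsub>G\<^esub>" using h.hom_one by simp
  have step: "h (frag_cmul k (frag_of a)) = [k] \<cdot>\<^bsub>G\<^esub> h (frag_of a)" if "a \<in> carrier M \<times> carrier M" for k a
    using h.hom_int_pow[of "frag_of a" k] that by (simp add: add_pow_def)
  have cl: "[k] \<cdot>\<^bsub>G\<^esub> h (frag_of a) \<in> carrier G" if "a \<in> carrier M \<times> carrier M" for k :: int and a
    using that h.hom_closed[of "frag_of a"] by (simp add: G.add.int_pow_closed)
  have cmul: "frag_cmul k (frag_of a) \<in> carrier F" if "a \<in> carrier M \<times> carrier M" for k a
    unfolding carrier_free_Abelian_group_iff
    by (rule order_trans[OF keys_cmul]) (simp add: that)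
  have "h (\<Sum>a\<in>A. frag_cmul (k a) (frag_of a)) = finsum G (\<lambda>a. [k a] \<cdot>\<^bsub>G\<^esub> h (frag_of a)) A"
    if "finite A" "A \<subseteq> carrier M \<times> carrier M" for A k
    using that
  proof (induction A rule: finite_induct)
    case (insert a A)
    have "frag_cmul (k a) (frag_of a) \<in> carrier F" "(\<Sum>a\<in>A. frag_cmul (k a) (frag_of a)) \<in> carrier F"
      using insert by (auto intro!: sum_closed_free_Abelian_group cmul simp del: carrier_free_Abelian_group_iff)
    then have "h (frag_cmul (k a) (frag_of a) + (\<Sum>a\<in>A. frag_cmul (k a) (frag_of a)))
        = h (frag_cmul (k a) (frag_of a)) \<oplus>\<^bsub>G\<^esub> h (\<Sum>a\<in>A. frag_cmul (k a) (frag_of a))"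
      using h.hom_mult by simp
    moreover have "a \<in> carrier M \<times> carrier M" "(\<lambda>a. [k a] \<cdot>\<^bsub>G\<^esub> h (frag_of a)) \<in> A \<rightarrow> carrier G"
      using insert.prems by (auto intro!: cl)
    ultimately show ?case using insert cl step by simp
  qed (simp add: h0)
  from this[of "Poly_Mapping.keys c" "Poly_Mapping.lookup c"] c show ?thesis
    using frag_expansion[of c] by (simp add: frag_extend_def)
qed

lemma balanced_mult: "balanced M (\<otimes>\<^bsub>M\<^esub>)"
  by (simp add: balanced_def M.l_distr M.r_distr M.m_assoc)

text \<open>The formula in \<open>mult_map\<close> computes the induced homomorphism on every
  representative, so its image of a coset is a singleton and \<open>the_elem\<close> is
  meaningful.\<close>

lemma mult_map_eq_lift:
  assumes "t \<in> carrier T"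
  shows "mult_map M t = lift M (\<otimes>\<^bsub>M\<^esub>) t"
proof -
  note l = lift_additive[OF M.abelian_group_axioms balanced_mult]
    lift_tens[OF M.abelian_group_axioms balanced_mult]
  have hom: "(\<lambda>c. lift M (\<otimes>\<^bsub>M\<^esub>) (cls c)) \<in> hom F (add_monoid M)"
    using hom_compose[OF cls_hom l(1)] by (simp add: comp_def)
  have *: "finsum M (\<lambda>(x, y). [Poly_Mapping.lookup c (x, y)] \<cdot>\<^bsub>M\<^esub> (x \<otimes>\<^bsub>M\<^esub> y)) (Poly_Mapping.keys c)
      = lift M (\<otimes>\<^bsub>M\<^esub>) (cls c)" if "c \<in> carrier F" for c
    unfolding hom_F_expand[OF M.abelian_group_axioms hom that]
    using that by (intro M.add.finprod_cong') (auto simp: l(2) M.add.int_pow_closed simp flip: tens_def)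
  obtain c where c: "c \<in> carrier F" "t = cls c" using assms by (auto simp: carrier_T)
  have "lift M (\<otimes>\<^bsub>M\<^esub>) (cls d) = lift M (\<otimes>\<^bsub>M\<^esub>) t" "d \<in> carrier F" if "d \<in> t" for d
  proof -
    show "d \<in> carrier F" using that c F.r_coset_subset_G[OF H.subset, of c] unfolding cls_def by blast
    then show "lift M (\<otimes>\<^bsub>M\<^esub>) (cls d) = lift M (\<otimes>\<^bsub>M\<^esub>) t"
      using that c F.repr_independence[of d H c] H.subgroup_axioms by (simp add: cls_def)
  qed
  moreover have "t \<noteq> {}" using c H.one_closed by (auto simp: cls_def r_coset_def)
  ultimately show ?thesis
    unfolding mult_map_def by (intro the_elem_image_unique) (auto simp: *)
qed

lemma mult_map_tens: "x \<in> carrier M \<Longrightarrow> y \<in> carrier M \<Longrightarrow> mult_map M (tens x y) = x \<otimes>\<^bsub>M\<^esub> y"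
  using lift_tens[OF M.abelian_group_axioms balanced_mult] by (simp add: mult_map_eq_lift)

lemma mult_map_additive: "mult_map M \<in> additive_maps T M"
  using lift_additive[OF M.abelian_group_axioms balanced_mult]
  by (simp add: hom_def mult_map_eq_lift Pi_iff)

lemmas mult_map_closed [simp, intro] = additive_closed[OF mult_map_additive]
  and mult_map_add = additive_add[OF mult_map_additive]

lemma mult_map_lact:
  assumes "p \<in> carrier M" "t \<in> carrier T"
  shows "mult_map M (lact T p t) = p \<otimes>\<^bsub>M\<^esub> mult_map M t"
  using assms(2) by (induction rule: tensor_induct)
    (simp_all add: assms lact_tens lact_add mult_map_tens mult_map_add M.m_assoc M.r_distr)

lemma mult_map_ract:
  assumes "p \<in> carrier M" "t \<in> carrier T"
  shows "mult_map M (ract T t p) = mult_map M t \<otimes>\<^bsub>M\<^esub> p"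
  using assms(2) by (induction rule: tensor_induct)
    (simp_all add: assms ract_tens ract_add mult_map_tens mult_map_add M.m_assoc M.l_distr)

end

section \<open>Casimir elements and their product\<close>

lemma frag_extend_fun_diff:
  "frag_extend (\<lambda>p. f p - g p) c = frag_extend f c - frag_extend g c"
  by (induction c rule: frag_induction[OF subset_UNIV]) (auto simp: frag_extend_diff)

lemma frag_extend_swap:
  "frag_extend (\<lambda>p. frag_extend (f p) d) c = frag_extend (\<lambda>q. frag_extend (\<lambda>p. f p q) c) d"
  by (induction c rule: frag_induction[OF subset_UNIV])
    (simp_all add: frag_extend_diff frag_extend_fun_diff frag_extend_eq_0)

text \<open>Extending over \<open>b'\<close> outermost opens the way to induction on the second
  argument: for a single pair the inner part is left and right multiplication on
  \<open>b\<close>.\<close>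

lemma casimir_mult_swap:
  "casimir_mult M b b' =
    frag_extend (\<lambda>(x', y'). frag_extend (\<lambda>(x, y). frag_of (x' \<otimes>\<^bsub>M\<^esub> x, y \<otimes>\<^bsub>M\<^esub> y')) b) b'"
  using frag_extend_swap[of "\<lambda>(x, y) (x', y'). frag_of (x' \<otimes>\<^bsub>M\<^esub> x, y \<otimes>\<^bsub>M\<^esub> y')" b' b]
  by (simp add: casimir_mult_def case_prod_unfold)

context ring_extension
begin

definition casimirs where
  "casimirs = {b \<in> carrier T. \<forall>n \<in> carrier N. lact T (\<eta> n) b = ract T b (\<eta> n)}"

lemma casimirs_carrier: "b \<in> casimirs \<Longrightarrow> b \<in> carrier T"
  by (simp add: casimirs_def)

lemma casimirsD: "b \<in> casimirs \<Longrightarrow> n \<in> carrier N \<Longrightarrow> lact T (\<eta> n) b = ract T b (\<eta> n)"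
  by (simp add: casimirs_def)

text \<open>The product \<open>bb'\<close> of Casimir elements is \<open>ins b b'\<close>: for \<open>b \<in> T\<^sup>N\<close>, \<open>ins b\<close> is the bimodule
  endomorphism \<open>x \<otimes> y \<mapsto> xb\<^sup>1 \<otimes> b\<^sup>2y\<close> of \<open>T\<close>.\<close>

definition ins where
  "ins b = lift T (\<lambda>x y. lact T x (ract T b y))"

text \<open>The balancing condition is N-centrality of \<open>b\<close>: moving
  \<open>\<eta> n\<close> from \<open>x\<close> to \<open>y\<close> exchanges its left and right
  action on \<open>b\<close>.\<close>

lemma balanced_ins: "b \<in> casimirs \<Longrightarrow> balanced T (\<lambda>x y. lact T x (ract T b y))"
  using casimirs_carrier[of b]
  by (simp add: balanced_def lact_add_left lact_add ract_add ract_add_right lact_mult ract_mult lact_ract casimirsD)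

lemmas ins_additive = lift_additive[OF T.abelian_group_axioms balanced_ins, folded ins_def]
  and ins_tens = lift_tens[OF T.abelian_group_axioms balanced_ins, folded ins_def]

lemmas ins_closed [simp, intro] = additive_closed[OF ins_additive]
  and ins_add = additive_add[OF ins_additive]
  and ins_minus = additive_minus[OF T.abelian_group_axioms T.abelian_group_axioms ins_additive]

lemma ins_lact:
  assumes "b \<in> casimirs" "p \<in> carrier M" "t \<in> carrier T"
  shows "ins b (lact T p t) = lact T p (ins b t)"
  using assms(3) by (induction rule: tensor_induct)
    (simp_all add: assms casimirs_carrier ins_tens lact_tens lact_add ins_add lact_mult)

lemma ins_ract:
  assumes "b \<in> casimirs" "p \<in> carrier M" "t \<in> carrier T"
  shows "ins b (ract T t p) = ract T (ins b t) p"
  using assms(3) by (induction rule: tensor_induct)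
    (simp_all add: assms casimirs_carrier ins_tens ract_tens ract_add ins_add ract_mult lact_ract)

lemma ins_casimirs:
  assumes "b \<in> casimirs" "b' \<in> casimirs"
  shows "ins b b' \<in> casimirs"
  using assms by (simp add: casimirs_def[of] flip: ins_lact ins_ract)

text \<open>Associativity of the Casimir product: the bimodule map \<open>ins b\<close> sends x b' y
  to x (\<open>ins b b'\<close>) y.\<close>

lemma ins_ins:
  assumes "b \<in> casimirs" "b' \<in> casimirs" "t \<in> carrier T"
  shows "ins b (ins b' t) = ins (ins b b') t"
  using assms(3) by (induction rule: tensor_induct)
    (simp_all add: assms casimirs_carrier ins_tens ins_add ins_lact ins_ract ins_casimirs)

lemma casimirs_add: "b \<in> casimirs \<Longrightarrow> b' \<in> casimirs \<Longrightarrow> b \<oplus>\<^bsub>T\<^esub> b' \<in> casimirs"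
  by (simp add: casimirs_def lact_add ract_add)

lemma casimirs_zero: "\<zero>\<^bsub>T\<^esub> \<in> casimirs"
  using additive_zero[OF T.abelian_group_axioms T.abelian_group_axioms lact_additive]
    additive_zero[OF T.abelian_group_axioms T.abelian_group_axioms ract_additive]
  by (simp add: casimirs_def)

text \<open>Provides additive inverses in the form of left multiplication by -1, under which
  \<open>casimirs\<close> is closed by \<open>lact_casimirs\<close>.\<close>

lemma lact_minus_one:
  assumes "t \<in> carrier T"
  shows "lact T (\<ominus>\<^bsub>M\<^esub> \<one>\<^bsub>M\<^esub>) t \<oplus>\<^bsub>T\<^esub> t = \<zero>\<^bsub>T\<^esub>"
proof -
  have "lact T (\<zero>\<^bsub>M\<^esub> \<oplus>\<^bsub>M\<^esub> \<zero>\<^bsub>M\<^esub>) t = lact T \<zero>\<^bsub>M\<^esub> t \<oplus>\<^bsub>T\<^esub> lact T \<zero>\<^bsub>M\<^esub> t"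
    using assms by (intro lact_add_left) auto
  then have "lact T \<zero>\<^bsub>M\<^esub> t = \<zero>\<^bsub>T\<^esub>" using assms by simp
  then show ?thesis
    using lact_add_left[of "\<ominus>\<^bsub>M\<^esub> \<one>\<^bsub>M\<^esub>" "\<one>\<^bsub>M\<^esub>" t] assms by (simp add: M.l_neg)
qed

lemma lact_casimirs:
  assumes "c \<in> carrier M" "\<And>n. n \<in> carrier N \<Longrightarrow> \<eta> n \<otimes>\<^bsub>M\<^esub> c = c \<otimes>\<^bsub>M\<^esub> \<eta> n" "b \<in> casimirs"
  shows "lact T c b \<in> casimirs"
proof -
  note b = casimirs_carrier[OF assms(3)]
  have "lact T (\<eta> n) (lact T c b) = ract T (lact T c b) (\<eta> n)" if n: "n \<in> carrier N" for n
  proof -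
    have "lact T (\<eta> n) (lact T c b) = lact T c (lact T (\<eta> n) b)"
      using n assms(1,2) b by (simp flip: lact_mult)
    then show ?thesis using n assms b by (simp add: casimirsD lact_ract)
  qed
  then show ?thesis using assms(1) b by (simp add: casimirs_def)
qed

lemma ins_add_left:
  assumes "b \<in> casimirs" "b' \<in> casimirs" "t \<in> carrier T"
  shows "ins (b \<oplus>\<^bsub>T\<^esub> b') t = ins b t \<oplus>\<^bsub>T\<^esub> ins b' t"
  using assms(3) by (induction rule: tensor_induct)
    (simp_all add: assms casimirs_carrier casimirs_add ins_tens ins_add lact_add ract_add T.a_ac)

lemma one_casimirs: "tens \<one>\<^bsub>M\<^esub> \<one>\<^bsub>M\<^esub> \<in> casimirs"
  using tens_balanced[of "\<one>\<^bsub>M\<^esub>" _ "\<one>\<^bsub>M\<^esub>"] by (simp add: casimirs_def lact_tens ract_tens)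

lemma ins_one_left: "t \<in> carrier T \<Longrightarrow> ins (tens \<one>\<^bsub>M\<^esub> \<one>\<^bsub>M\<^esub>) t = t"
  by (induction rule: tensor_induct) (simp_all add: one_casimirs ins_tens ins_add lact_tens ract_tens)

lemma ins_one_right: "b \<in> casimirs \<Longrightarrow> ins b (tens \<one>\<^bsub>M\<^esub> \<one>\<^bsub>M\<^esub>) = b"
  by (simp add: ins_tens casimirs_carrier)

text \<open>Only the first class has to be N-central, so the second argument runs through the whole
  free group by induction; on a basis pair (x, y) both sides are x (\<open>cls c\<close>) y.\<close>

lemma cls_casimir_mult:
  assumes c: "c \<in> carrier F" "cls c \<in> casimirs" and d: "d \<in> carrier F"
  shows "casimir_mult M c d \<in> carrier F \<and> cls (casimir_mult M c d) = ins (cls c) (cls d)"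
proof (rule free_Abelian_group_induct[OF d[simplified], where P = "\<lambda>d. casimir_mult M c d \<in> carrier F \<and>
    cls (casimir_mult M c d) = ins (cls c) (cls d)"], goal_cases)
  case 1
  have "cls 0 = \<zero>\<^bsub>T\<^esub>"
    using hom_one[OF cls_hom] T.a_group by simp
  then show ?case
    using additive_zero[OF T.abelian_group_axioms T.abelian_group_axioms ins_additive[OF c(2)]]
    by (simp add: casimir_mult_swap)
next
  case (2 d e)
  then have "cls d \<in> carrier T" "cls e \<in> carrier T" by (auto simp: carrier_T)
  then show ?case
    using 2 by (simp add: casimir_mult_swap frag_extend_diff cls_diff keys_diff_subset ins_minus[OF c(2)])
next
  case (3 a)
  then obtain x y where a: "a = (x, y)" "x \<in> carrier M" "y \<in> carrier M" by auto
  \<comment> \<open>A representative of \<open>cls c\<close> acted on by \<open>y\<close> from the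
    right; the left action of \<open>x\<close> on it then yields
    \<open>casimir_mult\<close>.\<close>
  let ?r = "frag_extend (\<lambda>(u, v). frag_of (u, v \<otimes>\<^bsub>M\<^esub> y)) c"
  have r: "?r \<in> carrier F" by (rule frag_extend_closed[OF c(1)]) (simp add: a)
  have e: "casimir_mult M c (frag_of a) = frag_extend (\<lambda>(u, v). frag_of (x \<otimes>\<^bsub>M\<^esub> u, v)) ?r"
    using frag_extend_compose[of "\<lambda>(u, v). frag_of (x \<otimes>\<^bsub>M\<^esub> u, v)" "\<lambda>(u, v). (u, v \<otimes>\<^bsub>M\<^esub> y)" c]
    by (simp add: casimir_mult_swap a comp_def case_prod_unfold)
  have "casimir_mult M c (frag_of a) \<in> carrier F"
    unfolding e by (rule frag_extend_closed[OF r]) (simp add: a)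
  moreover have "ins (cls c) (cls (frag_of a)) = lact T x (ract T (cls c) y)"
    using ins_tens[OF c(2) a(2,3)] by (simp add: tens_def a(1))
  ultimately show ?case
    using lact_cls[OF a(2) r] ract_cls[OF a(3) c(1)] e by simp
qed

text \<open>The left side is the union of the \<open>H\<close>-cosets of all products of
  representatives. Each of them is \<open>ins b b'\<close> by \<open>cls_casimir_mult\<close>, and
  neither factor is empty.\<close>

lemma casimir_mult_eq_ins:
  assumes "b \<in> casimirs" "b' \<in> casimirs"
  shows "H <#>\<^bsub>F\<^esub> {casimir_mult M c c' | c c'. c \<in> b \<and> c' \<in> b'} = ins b b'"
proof -
  have rep: "c \<in> carrier F \<and> cls c = t" if ct: "c \<in> t" and t: "t \<in> carrier T" for c t
  proof -
    obtain d where d: "d \<in> carrier F" "t = cls d" using t by (auto simp: carrier_T)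
    have "c \<in> carrier F" using ct d F.r_coset_subset_G[OF H.subset, of d] unfolding cls_def by blast
    moreover have "cls c = t"
      using ct d F.repr_independence[of c H d] H.subgroup_axioms by (simp add: cls_def)
    ultimately show ?thesis by blast
  qed
  have ne: "\<exists>c. c \<in> t" if t: "t \<in> carrier T" for t
  proof -
    obtain d where d: "d \<in> carrier F" "t = cls d" using t by (auto simp: carrier_T)
    then show ?thesis using F.rcos_self[OF d(1) H.subgroup_axioms] by (auto simp: cls_def)
  qed
  have *: "H #>\<^bsub>F\<^esub> casimir_mult M c c' = ins b b'" if "c \<in> b" "c' \<in> b'" for c c'
    using cls_casimir_mult[of c c'] rep[OF that(1)] rep[OF that(2)] assms
    by (simp add: casimirs_carrier flip: cls_def)
  have "H <#>\<^bsub>F\<^esub> {casimir_mult M c c' | c c'. c \<in> b \<and> c' \<in> b'}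
      = (\<Union>c\<in>b. \<Union>c'\<in>b'. H #>\<^bsub>F\<^esub> casimir_mult M c c')"
    unfolding set_mult_def r_coset_def by blast
  also have "\<dots> = ins b b'"
    using * ne[of b] ne[of b'] assms by (auto simp: casimirs_carrier)
  finally show ?thesis .
qed

end

section \<open>Depth two\<close>

lemma bimodule_homD:
  assumes "f \<in> bimodule_hom P Q U V"
  shows "f \<in> additive_maps U V"
    and "\<And>p x. p \<in> carrier P \<Longrightarrow> x \<in> carrier U \<Longrightarrow> f (lact U p x) = lact V p (f x)"
    and "\<And>q x. q \<in> carrier Q \<Longrightarrow> x \<in> carrier U \<Longrightarrow> f (ract U x q) = ract V (f x) q"
  using assms by (auto simp: bimodule_hom_def hom_def)

lemma bimodule_homI:
  assumes "f \<in> additive_maps U V"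
    and "\<And>p x. p \<in> carrier P \<Longrightarrow> x \<in> carrier U \<Longrightarrow> f (lact U p x) = lact V p (f x)"
    and "\<And>q x. q \<in> carrier Q \<Longrightarrow> x \<in> carrier U \<Longrightarrow> f (ract U x q) = ract V (f x) q"
  shows "f \<in> bimodule_hom P Q U V"
  using assms by (auto simp: bimodule_hom_def hom_def)

text \<open>The retraction is the projection to the summand along its complement, followed by the
  inverse of the given isomorphism.\<close>

lemma direct_summand_retraction:
  assumes U: "abelian_group U" and V: "abelian_group V" and ds: "iso_direct_summand P Q U V"
    and closedU: "\<And>p x. p \<in> carrier P \<Longrightarrow> x \<in> carrier U \<Longrightarrow> lact U p x \<in> carrier U"
      "\<And>q x. q \<in> carrier Q \<Longrightarrow> x \<in> carrier U \<Longrightarrow> ract U x q \<in> carrier U"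
    and lact: "\<And>p x y. \<lbrakk>p \<in> carrier P; x \<in> carrier V; y \<in> carrier V\<rbrakk> \<Longrightarrow>
      lact V p (x \<oplus>\<^bsub>V\<^esub> y) = lact V p x \<oplus>\<^bsub>V\<^esub> lact V p y"
    and ract: "\<And>q x y. \<lbrakk>q \<in> carrier Q; x \<in> carrier V; y \<in> carrier V\<rbrakk> \<Longrightarrow>
      ract V (x \<oplus>\<^bsub>V\<^esub> y) q = ract V x q \<oplus>\<^bsub>V\<^esub> ract V y q"
  obtains f g where "f \<in> bimodule_hom P Q U V" "g \<in> bimodule_hom P Q V U"
    "\<And>x. x \<in> carrier U \<Longrightarrow> g (f x) = x"
proof -
  interpret U: abelian_group U by fact
  interpret V: abelian_group V by fact
  obtain S W f where S: "subbimodule P Q S V" and W: "subbimodule P Q W V"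
    and SW: "S \<inter> W = {\<zero>\<^bsub>V\<^esub>}" "S <+>\<^bsub>V\<^esub> W = carrier V"
    and f: "f \<in> bimodule_hom P Q U (V\<lparr>carrier := S\<rparr>)" "bij_betw f (carrier U) S"
    using ds unfolding iso_direct_summand_def by blast
  interpret S: additive_subgroup S V using S by (simp add: subbimodule_def)
  interpret W: additive_subgroup W V using W by (simp add: subbimodule_def)
  have fS: "f x \<in> S" if "x \<in> carrier U" for x
    using bij_betw_apply[OF f(2) that] .
  have f_hom: "f \<in> bimodule_hom P Q U V"
    using f(1) fS S.a_subset by (fastforce simp: bimodule_hom_def)
  note fV = additive_closed[OF bimodule_homD(1)[OF f_hom]]
  \<comment> \<open>\<open>D v x\<close> says that \<open>f x\<close> is the component of
    \<open>v\<close> in \<open>S\<close>.\<close>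
  define D where "D v x \<longleftrightarrow> x \<in> carrier U \<and> (\<exists>w \<in> W. v = f x \<oplus>\<^bsub>V\<^esub> w)" for v x
  have WV: "w \<in> carrier V" if "w \<in> W" for w using that W.a_subset by blast
  have D_unique: "x = y" if xy: "D v x" "D v y" for v x y
  proof -
    obtain w w' where w: "w \<in> W" "w' \<in> W" "f x \<oplus>\<^bsub>V\<^esub> w = f y \<oplus>\<^bsub>V\<^esub> w'"
      and x: "x \<in> carrier U" "y \<in> carrier U" using xy by (auto simp: D_def)
    have cl: "f x \<in> carrier V" "f y \<in> carrier V" "w \<in> carrier V" "w' \<in> carrier V"
      using w x fV WV by auto
    \<comment> \<open>This difference lies in \<open>S\<close> and in \<open>W\<close>, hence is
      zero; injectivity of \<open>f\<close> then gives \<open>x = y\<close>.\<close>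
    have eq: "f x \<ominus>\<^bsub>V\<^esub> f y = w' \<ominus>\<^bsub>V\<^esub> w"
      by (rule V.diff_eq_diffI[OF w(3) cl(1,3,2,4)])
    moreover have "f x \<ominus>\<^bsub>V\<^esub> f y \<in> S" "w' \<ominus>\<^bsub>V\<^esub> w \<in> W"
      using fS x w by (auto simp: V.minus_eq intro!: S.a_closed W.a_closed S.a_inv_closed W.a_inv_closed)
    ultimately have "f x \<ominus>\<^bsub>V\<^esub> f y = \<zero>\<^bsub>V\<^esub>" using SW(1) eq by auto
    moreover have "f x = (f x \<ominus>\<^bsub>V\<^esub> f y) \<oplus>\<^bsub>V\<^esub> f y"
      using cl by (simp add: V.minus_eq V.a_assoc V.l_neg)
    ultimately have "f x = f y" using cl by simp
    then show "x = y" using f(2) x by (auto simp: bij_betw_def dest: inj_onD)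
  qed
  have D_exists: "\<exists>x. D v x" if v: "v \<in> carrier V" for v
  proof -
    have "v \<in> S <+>\<^bsub>V\<^esub> W" using v SW(2) by simp
    then obtain s w where "s \<in> S" "w \<in> W" "v = s \<oplus>\<^bsub>V\<^esub> w"
      by (auto simp: set_add_def set_mult_def)
    then show ?thesis using f(2) by (auto simp: D_def bij_betw_def)
  qed
  define g where "g v = (THE x. D v x)" for v
  have g: "D v x \<Longrightarrow> g v = x" for v x
    unfolding g_def using D_unique by (intro the_equality)
  have gD: "v \<in> carrier V \<Longrightarrow> D v (g v)" for v
    using D_exists g by metis
  \<comment> \<open>Since \<open>W\<close> is a subbimodule and \<open>f\<close> a bimodule map,
    sums and actions of decompositions are decompositions again; uniqueness then gives the values of
    \<open>g\<close>.\<close>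
  have "g \<in> bimodule_hom P Q V U"
  proof (intro bimodule_homI additiveI)
    fix v assume v: "v \<in> carrier V"
    then obtain w where w: "w \<in> W" "v = f (g v) \<oplus>\<^bsub>V\<^esub> w" and gv: "g v \<in> carrier U"
      using gD by (auto simp: D_def)
    show "g v \<in> carrier U" by fact
    { fix v' assume "v' \<in> carrier V"
      then obtain w' where w': "w' \<in> W" "v' = f (g v') \<oplus>\<^bsub>V\<^esub> w'" and gv': "g v' \<in> carrier U"
        using gD by (auto simp: D_def)
      have "(f (g v) \<oplus>\<^bsub>V\<^esub> w) \<oplus>\<^bsub>V\<^esub> (f (g v') \<oplus>\<^bsub>V\<^esub> w')
          = f (g v \<oplus>\<^bsub>U\<^esub> g v') \<oplus>\<^bsub>V\<^esub> (w \<oplus>\<^bsub>V\<^esub> w')"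
        using gv gv' w(1) w'(1) fV WV
        by (simp add: additive_add[OF bimodule_homD(1)[OF f_hom]] V.a_ac)
      then have "v \<oplus>\<^bsub>V\<^esub> v' = f (g v \<oplus>\<^bsub>U\<^esub> g v') \<oplus>\<^bsub>V\<^esub> (w \<oplus>\<^bsub>V\<^esub> w')"
        using w(2) w'(2) by simp
      then show "g (v \<oplus>\<^bsub>V\<^esub> v') = g v \<oplus>\<^bsub>U\<^esub> g v'"
        using gv gv' w(1) w'(1) by (intro g) (auto simp: D_def intro!: bexI[of _ "w \<oplus>\<^bsub>V\<^esub> w'"])
    }
    { fix p assume p: "p \<in> carrier P"
      have "lact V p w \<in> W" using W p w(1) by (simp add: subbimodule_def)
      moreover have "lact V p (f (g v) \<oplus>\<^bsub>V\<^esub> w) = f (lact U p (g v)) \<oplus>\<^bsub>V\<^esub> lact V p w"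
        using p gv w(1) fV WV by (simp add: lact bimodule_homD(2)[OF f_hom])
      then have "lact V p v = f (lact U p (g v)) \<oplus>\<^bsub>V\<^esub> lact V p w" using w(2) by simp
      ultimately show "g (lact V p v) = lact U p (g v)"
        using gv p closedU(1) by (intro g) (auto simp: D_def)
    }
    { fix q assume q: "q \<in> carrier Q"
      have "ract V w q \<in> W" using W q w(1) by (simp add: subbimodule_def)
      moreover have "ract V (f (g v) \<oplus>\<^bsub>V\<^esub> w) q = f (ract U (g v) q) \<oplus>\<^bsub>V\<^esub> ract V w q"
        using q gv w(1) fV WV by (simp add: ract bimodule_homD(3)[OF f_hom])
      then have "ract V v q = f (ract U (g v) q) \<oplus>\<^bsub>V\<^esub> ract V w q" using w(2) by simp
      ultimately show "g (ract V v q) = ract U (g v) q"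
        using gv q closedU(2) by (intro g) (auto simp: D_def)
    }
  qed
  moreover have "g (f x) = x" if "x \<in> carrier U" for x
    using that fV[OF that] W.zero_closed by (intro g) (auto simp: D_def intro!: bexI[of _ "\<zero>\<^bsub>V\<^esub>"])
  ultimately show thesis using that f_hom by blast
qed

context ring_extension
begin

section \<open>Direct powers of \<open>M\<close> and their coordinates\<close>

abbreviation "V r \<equiv> direct_power r (as_MN M \<eta>)"
abbreviation "U \<equiv> restrict_scalars (\<lambda>m. m) \<eta> T"

lemma V_simps:
  "carrier (V r) = {..<r} \<rightarrow>\<^sub>E carrier M"
  "\<zero>\<^bsub>V r\<^esub> = (\<lambda>i\<in>{..<r}. \<zero>\<^bsub>M\<^esub>)"
  "v \<oplus>\<^bsub>V r\<^esub> w = (\<lambda>i\<in>{..<r}. v i \<oplus>\<^bsub>M\<^esub> w i)"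
  "lact (V r) p v = (\<lambda>i\<in>{..<r}. p \<otimes>\<^bsub>M\<^esub> v i)"
  "ract (V r) v n = (\<lambda>i\<in>{..<r}. v i \<otimes>\<^bsub>M\<^esub> \<eta> n)"
  by (simp_all add: direct_power_def restrict_scalars_def regular_bimodule_def)

lemma U_simps:
  "carrier U = carrier T" "s \<oplus>\<^bsub>U\<^esub> t = s \<oplus>\<^bsub>T\<^esub> t" "\<zero>\<^bsub>U\<^esub> = \<zero>\<^bsub>T\<^esub>"
  "lact U p t = lact T p t" "ract U t n = ract T t (\<eta> n)"
  by (simp_all add: restrict_scalars_def)

lemma abelian_group_U: "abelian_group U"
proof (rule abelian_groupI)
  show "\<exists>y \<in> carrier U. y \<oplus>\<^bsub>U\<^esub> x = \<zero>\<^bsub>U\<^esub>" if "x \<in> carrier U" for x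
    using that T.l_neg T.a_inv_closed unfolding U_simps by blast
qed (simp_all add: U_simps T.a_ac)

lemma V_eqI:
  assumes "v \<in> carrier (V r)" "w \<in> carrier (V r)" "\<And>i. i < r \<Longrightarrow> v i = w i"
  shows "v = w"
  using assms unfolding V_simps by (intro PiE_ext[of v]) auto

lemma V_nth_closed: "v \<in> carrier (V r) \<Longrightarrow> i < r \<Longrightarrow> v i \<in> carrier M"
  by (auto simp: V_simps)

lemma V_closed:
  "\<zero>\<^bsub>V r\<^esub> \<in> carrier (V r)"
  "v \<in> carrier (V r) \<Longrightarrow> w \<in> carrier (V r) \<Longrightarrow> v \<oplus>\<^bsub>V r\<^esub> w \<in> carrier (V r)"
  "p \<in> carrier M \<Longrightarrow> v \<in> carrier (V r) \<Longrightarrow> lact (V r) p v \<in> carrier (V r)"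
  "n \<in> carrier N \<Longrightarrow> v \<in> carrier (V r) \<Longrightarrow> ract (V r) v n \<in> carrier (V r)"
  by (auto simp: V_simps)

lemma V_nth:
  "i < r \<Longrightarrow> \<zero>\<^bsub>V r\<^esub> i = \<zero>\<^bsub>M\<^esub>"
  "i < r \<Longrightarrow> (v \<oplus>\<^bsub>V r\<^esub> w) i = v i \<oplus>\<^bsub>M\<^esub> w i"
  "i < r \<Longrightarrow> lact (V r) p v i = p \<otimes>\<^bsub>M\<^esub> v i"
  "i < r \<Longrightarrow> ract (V r) v n i = v i \<otimes>\<^bsub>M\<^esub> \<eta> n"
  by (simp_all add: V_simps)

lemma abelian_group_V: "abelian_group (V r)"
proof (rule abelian_groupI)
  show "\<exists>y \<in> carrier (V r). y \<oplus>\<^bsub>V r\<^esub> x = \<zero>\<^bsub>V r\<^esub>" if x: "x \<in> carrier (V r)" for x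
  proof
    show cl: "(\<lambda>i\<in>{..<r}. \<ominus>\<^bsub>M\<^esub> x i) \<in> carrier (V r)"
      using V_nth_closed[OF x] by (simp add: V_simps(1))
    show "(\<lambda>i\<in>{..<r}. \<ominus>\<^bsub>M\<^esub> x i) \<oplus>\<^bsub>V r\<^esub> x = \<zero>\<^bsub>V r\<^esub>"
      by (rule V_eqI[OF V_closed(2)[OF cl x] V_closed(1)]) (simp add: V_nth M.l_neg V_nth_closed[OF x])
  qed
qed (auto intro!: V_closed V_eqI simp: V_nth V_nth_closed M.a_ac)

definition single :: "nat \<Rightarrow> nat \<Rightarrow> 'm \<Rightarrow> nat \<Rightarrow> 'm" where
  "single r k m = (\<lambda>i\<in>{..<r}. if i = k then m else \<zero>\<^bsub>M\<^esub>)"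

lemma single_closed: "m \<in> carrier M \<Longrightarrow> single r k m \<in> carrier (V r)"
  by (simp add: single_def V_simps(1))

text \<open>Induction over index sets \<open>J\<close>: the partial sum agrees with \<open>v\<close>
  on \<open>J\<close> and vanishes at the other indices.\<close>

lemma sum_single:
  assumes "v \<in> carrier (V r)"
  shows "finsum (V r) (\<lambda>k. single r k (v k)) {..<r} = v"
proof -
  interpret V: abelian_group "V r" by (rule abelian_group_V)
  note v = V_nth_closed[OF assms]
  have "finsum (V r) (\<lambda>k. single r k (v k)) J = (\<lambda>i\<in>{..<r}. if i \<in> J then v i else \<zero>\<^bsub>M\<^esub>)"
    if "finite J" "J \<subseteq> {..<r}" for J
    using that
  proof (induction J rule: finite_induct)
    case empty
    then show ?case by (simp add: V_simps(2))
  next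
    case (insert k J)
    then have "(\<lambda>k. single r k (v k)) \<in> J \<rightarrow> carrier (V r)" "single r k (v k) \<in> carrier (V r)"
      using v by (auto intro!: single_closed)
    then have "finsum (V r) (\<lambda>k. single r k (v k)) (insert k J)
        = single r k (v k) \<oplus>\<^bsub>V r\<^esub> finsum (V r) (\<lambda>k. single r k (v k)) J"
      using insert(1,2) by simp
    also have "\<dots> = single r k (v k) \<oplus>\<^bsub>V r\<^esub> (\<lambda>i\<in>{..<r}. if i \<in> J then v i else \<zero>\<^bsub>M\<^esub>)"
      by (subst insert.IH) (use insert.prems in auto)
    also have "\<dots> = (\<lambda>i\<in>{..<r}. if i \<in> insert k J then v i else \<zero>\<^bsub>M\<^esub>)"
      using insert.hyps insert.prems v
      by (intro V_eqI[of _ r] V_closed single_closed) (auto simp: V_nth single_def V_simps(1))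
    finally show ?case .
  qed
  from this[of "{..<r}"] show ?thesis
    using v by (intro V_eqI[OF _ assms]) (auto simp: V_simps(1))
qed

text \<open>Depth two embeds \<open>T\<close> into a power of \<open>M\<close> by \<open>F'\<close>
  with a retraction \<open>G\<close>. The \<open>f k\<close> are the coordinates of
  \<open>F'\<close>, the \<open>b k\<close> are the images of the unit vectors under
  \<open>G\<close>, and the expansion is \<open>G (F' t) = t\<close>.\<close>

lemma depth_two_quasibasis:
  assumes "depth_two N M \<eta>"
  obtains r :: nat and f b where
    "\<And>k. k < r \<Longrightarrow> f k \<in> additive_maps T M"
    "\<And>k p t. \<lbrakk>k < r; p \<in> carrier M; t \<in> carrier T\<rbrakk> \<Longrightarrow> f k (lact T p t) = p \<otimes>\<^bsub>M\<^esub> f k t"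
    "\<And>k n t. \<lbrakk>k < r; n \<in> carrier N; t \<in> carrier T\<rbrakk> \<Longrightarrow> f k (ract T t (\<eta> n)) = f k t \<otimes>\<^bsub>M\<^esub> \<eta> n"
    "\<And>k. k < r \<Longrightarrow> b k \<in> casimirs"
    "\<And>t. t \<in> carrier T \<Longrightarrow> finsum T (\<lambda>k. lact T (f k t) (b k)) {..<r} = t"
proof -
  obtain r where ds: "iso_direct_summand M N U (V r)"
    using assms unfolding depth_two_def by blast
  obtain F' G where F': "F' \<in> bimodule_hom M N U (V r)" and G: "G \<in> bimodule_hom M N (V r) U"
    and GF: "\<And>x. x \<in> carrier U \<Longrightarrow> G (F' x) = x"
  proof (rule direct_summand_retraction[OF abelian_group_U abelian_group_V ds])
    show "lact (V r) p (x \<oplus>\<^bsub>V r\<^esub> y) = lact (V r) p x \<oplus>\<^bsub>V r\<^esub> lact (V r) p y"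
      if "p \<in> carrier M" "x \<in> carrier (V r)" "y \<in> carrier (V r)" for p x y
      using that by (intro V_eqI[of _ r]) (auto simp: V_nth V_nth_closed M.r_distr intro!: V_closed)
    show "ract (V r) (x \<oplus>\<^bsub>V r\<^esub> y) n = ract (V r) x n \<oplus>\<^bsub>V r\<^esub> ract (V r) y n"
      if "n \<in> carrier N" "x \<in> carrier (V r)" "y \<in> carrier (V r)" for n x y
      using that by (intro V_eqI[of _ r]) (auto simp: V_nth V_nth_closed M.l_distr intro!: V_closed)
  qed (auto simp: U_simps)
  note FV = additive_closed[OF bimodule_homD(1)[OF F'], unfolded U_simps]
  note GT = additive_closed[OF bimodule_homD(1)[OF G], unfolded U_simps]
  define f where "f k t = F' t k" for k t
  define b where "b k = G (single r k \<one>\<^bsub>M\<^esub>)" for k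
  have f_closed: "f k t \<in> carrier M" if "k < r" "t \<in> carrier T" for k t
    using V_nth_closed[OF FV[OF that(2)] that(1)] by (simp add: f_def)
  have G_single: "G (single r k m) = lact T m (b k)" if "m \<in> carrier M" for k m
  proof -
    have "single r k m = lact (V r) m (single r k \<one>\<^bsub>M\<^esub>)"
      using that by (intro V_eqI[of _ r]) (auto simp: V_nth intro!: V_closed single_closed, simp add: single_def)
    then show ?thesis
      using bimodule_homD(2)[OF G that single_closed[of "\<one>\<^bsub>M\<^esub>" r k]] by (simp add: b_def U_simps)
  qed
  show thesis
  proof (rule that[of r f b])
    show "f k \<in> additive_maps T M" if "k < r" for k
      using f_closed[OF that] additive_add[OF bimodule_homD(1)[OF F'], unfolded U_simps] that
      by (intro additiveI) (simp_all add: f_def V_nth)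
    show "f k (lact T p t) = p \<otimes>\<^bsub>M\<^esub> f k t" if "k < r" "p \<in> carrier M" "t \<in> carrier T" for k p t
      using bimodule_homD(2)[OF F', unfolded U_simps, OF that(2,3)] that(1) by (simp add: f_def V_nth)
    show "f k (ract T t (\<eta> n)) = f k t \<otimes>\<^bsub>M\<^esub> \<eta> n" if "k < r" "n \<in> carrier N" "t \<in> carrier T" for k n t
      using bimodule_homD(3)[OF F', unfolded U_simps, OF that(2,3)] that(1) by (simp add: f_def V_nth)
    show "b k \<in> casimirs" if "k < r" for k
    proof -
      have bk: "b k \<in> carrier T" unfolding b_def by (intro GT single_closed) simp
      have "lact T (\<eta> n) (b k) = ract T (b k) (\<eta> n)" if n: "n \<in> carrier N" for n
      proof -
        \<comment> \<open>Left and right multiplication of a unit vector by \<open>\<eta> n\<close>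
          agree, and \<open>G\<close> transports this to \<open>b k\<close>.\<close>
        have "single r k (\<eta> n) = ract (V r) (single r k \<one>\<^bsub>M\<^esub>) n"
          using n by (intro V_eqI[of _ r]) (auto simp: V_nth intro!: V_closed single_closed, simp add: single_def)
        then show ?thesis
          using G_single[of "\<eta> n" k] bimodule_homD(3)[OF G n single_closed[of "\<one>\<^bsub>M\<^esub>" r k]] n
          by (simp add: b_def U_simps)
      qed
      then show ?thesis using bk by (simp add: casimirs_def)
    qed
    show "finsum T (\<lambda>k. lact T (f k t) (b k)) {..<r} = t" if t: "t \<in> carrier T" for t
    proof -
      interpret V: abelian_group "V r" by (rule abelian_group_V)
      have G_add: "G \<in> additive_maps (V r) T"
        using bimodule_homD(1)[OF G] by (simp add: hom_def U_simps)
      have "t = G (finsum (V r) (\<lambda>k. single r k (f k t)) {..<r})"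
        using sum_single[OF FV[OF t]] GF t by (simp add: f_def U_simps)
      also have "\<dots> = finsum T (\<lambda>k. G (single r k (f k t))) {..<r}"
        using f_closed t
        by (intro additive_finsum[OF abelian_group_V T.abelian_group_axioms G_add] single_closed) auto
      also have "\<dots> = finsum T (\<lambda>k. lact T (f k t) (b k)) {..<r}"
        using f_closed[OF _ t] GT[OF single_closed[of "\<one>\<^bsub>M\<^esub>" r], folded b_def]
        by (intro T.finsum_cong') (auto simp: G_single)
      finally show ?thesis by simp
    qed
  qed
qed

section \<open>Separability elements\<close>

lemma regular_bimodule_simps:
  "carrier (regular_bimodule M) = carrier M" "x \<oplus>\<^bsub>regular_bimodule M\<^esub> y = x \<oplus>\<^bsub>M\<^esub> y"
  "lact (regular_bimodule M) x y = x \<otimes>\<^bsub>M\<^esub> y" "ract (regular_bimodule M) x y = x \<otimes>\<^bsub>M\<^esub> y"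
  by (simp_all add: regular_bimodule_def)

text \<open>A section \<open>s\<close> of the multiplication is determined by e = s(1), because s(m)
  = m e = e m. Conversely, m \<mapsto> m e is right linear because e commutes with
  \<open>M\<close>.\<close>

lemma separable_extension_iff:
  "separable_extension N M \<eta> \<longleftrightarrow>
    (\<exists>e \<in> carrier T. (\<forall>m \<in> carrier M. lact T m e = ract T e m) \<and> mult_map M e = \<one>\<^bsub>M\<^esub>)"
proof
  assume "separable_extension N M \<eta>"
  then obtain s where s: "s \<in> bimodule_hom M M (regular_bimodule M) T"
    "\<And>y. y \<in> carrier M \<Longrightarrow> mult_map M (s y) = y"
    unfolding separable_extension_def split_bimodule_epi_def by (auto simp: regular_bimodule_simps)
  note h = bimodule_homD(2,3)[OF s(1), unfolded regular_bimodule_simps]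
  show "\<exists>e \<in> carrier T. (\<forall>m \<in> carrier M. lact T m e = ract T e m) \<and> mult_map M e = \<one>\<^bsub>M\<^esub>"
  proof (intro bexI conjI ballI)
    show "lact T m (s \<one>\<^bsub>M\<^esub>) = ract T (s \<one>\<^bsub>M\<^esub>) m" if "m \<in> carrier M" for m
      using h(1)[OF that, of "\<one>\<^bsub>M\<^esub>"] h(2)[OF that, of "\<one>\<^bsub>M\<^esub>"] that by simp
    show "s \<one>\<^bsub>M\<^esub> \<in> carrier T"
      using additive_closed[OF bimodule_homD(1)[OF s(1)], of "\<one>\<^bsub>M\<^esub>"] by (simp add: regular_bimodule_simps)
  qed (simp add: s(2))
next
  assume "\<exists>e \<in> carrier T. (\<forall>m \<in> carrier M. lact T m e = ract T e m) \<and> mult_map M e = \<one>\<^bsub>M\<^esub>"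
  then obtain e where e: "e \<in> carrier T" "\<And>m. m \<in> carrier M \<Longrightarrow> lact T m e = ract T e m"
    "mult_map M e = \<one>\<^bsub>M\<^esub>" by blast
  have "(\<lambda>m. lact T m e) \<in> bimodule_hom M M (regular_bimodule M) T"
  proof (intro bimodule_homI additiveI)
    show "lact T (ract (regular_bimodule M) x q) e = ract T (lact T x e) q"
      if "q \<in> carrier M" "x \<in> carrier (regular_bimodule M)" for q x
      using that e(1) by (simp add: regular_bimodule_simps lact_mult e(2)[OF that(1)] lact_ract)
  qed (simp_all add: regular_bimodule_simps e(1) lact_mult lact_add_left)
  moreover have "mult_map M \<in> bimodule_hom M M T (regular_bimodule M)"
    by (intro bimodule_homI additiveI)
      (simp_all add: regular_bimodule_simps mult_map_lact mult_map_ract mult_map_add)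
  moreover have "mult_map M (lact T m e) = m" if "m \<in> carrier M" for m
    using that e(1,3) by (simp add: mult_map_lact)
  ultimately show "separable_extension N M \<eta>"
    unfolding separable_extension_def split_bimodule_epi_def
    unfolding regular_bimodule_simps by (intro conjI bexI[of _ "\<lambda>m. lact T m e"] ballI)
qed

end

section \<open>The algebra of Casimir elements\<close>

context assoc_algebra
begin

lemma unit_smult_mult:
  assumes "k \<in> carrier K" "x \<in> carrier A"
  shows "(k \<odot>\<^bsub>A\<^esub> \<one>\<^bsub>A\<^esub>) \<otimes>\<^bsub>A\<^esub> x = k \<odot>\<^bsub>A\<^esub> x" "x \<otimes>\<^bsub>A\<^esub> (k \<odot>\<^bsub>A\<^esub> \<one>\<^bsub>A\<^esub>) = k \<odot>\<^bsub>A\<^esub> x"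
  using assms by (simp_all add: smult_mult_left smult_mult_right)

lemma ring_extension_unit: "ring_extension K A (\<lambda>k. k \<odot>\<^bsub>A\<^esub> \<one>\<^bsub>A\<^esub>)"
proof (intro ring_extension.intro ring_extension_axioms.intro ring_hom_memI)
  show "ring K" by (rule R.ring_axioms)
  show "ring A" by (rule A.ring_axioms)
qed (simp_all add: smult_l_distr smult_assoc1 unit_smult_mult(1))

end

locale irreducible_algebra_extension = algebra_extension K N M \<eta>
  for K :: "('k, 'x) ring_scheme" and N :: "('k, 'n, 'y) module_scheme"
    and M :: "('k, 'm, 'z) module_scheme" and \<eta> +
  assumes irreducible: "irreducible_extension K N M \<eta>"

sublocale irreducible_algebra_extension \<subseteq> ring_extension N M \<eta>
  by (intro ring_extension.intro ring_extension_axioms.intro eta_hom N.A.ring_axioms M.A.ring_axioms)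

context irreducible_algebra_extension
begin

section \<open>The centralizer and the algebra structure of \<open>B\<close>\<close>

abbreviation "Z \<equiv> centralizer N M \<eta>"
abbreviation "B \<equiv> casimir_algebra N M \<eta>"

lemma Z_closed: "c \<in> Z \<Longrightarrow> c \<in> carrier M"
  by (simp add: centralizer_def)

lemma scalar_Z: "k \<in> carrier K \<Longrightarrow> k \<odot>\<^bsub>M\<^esub> \<one>\<^bsub>M\<^esub> \<in> Z"
  using irreducible by (auto simp: irreducible_extension_def bij_betw_def)

lemma Z_scalar: "c \<in> Z \<Longrightarrow> \<exists>k \<in> carrier K. c = k \<odot>\<^bsub>M\<^esub> \<one>\<^bsub>M\<^esub>"
  using irreducible by (auto simp: irreducible_extension_def bij_betw_def)

text \<open>Irreducibility enters here: what commutes with the image of \<open>N\<close> is a scalar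
  multiple of 1, and so commutes with all of \<open>M\<close>.\<close>

lemma Z_central: "c \<in> Z \<Longrightarrow> m \<in> carrier M \<Longrightarrow> c \<otimes>\<^bsub>M\<^esub> m = m \<otimes>\<^bsub>M\<^esub> c"
  using Z_scalar[of c] by (auto simp: M.unit_smult_mult)

lemma lact_Z_casimirs: "c \<in> Z \<Longrightarrow> b \<in> casimirs \<Longrightarrow> lact T c b \<in> casimirs"
  by (intro lact_casimirs) (auto simp: centralizer_def)

text \<open>The central factor passes \<open>x\<close>: x (c b) y = c (x b y). This makes the
  product of \<open>B\<close> linear over \<open>K\<close> in its first factor.\<close>

lemma ins_lact_left:
  assumes "c \<in> Z" "b \<in> casimirs" "t \<in> carrier T"
  shows "ins (lact T c b) t = lact T c (ins b t)"
  using assms(3)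
proof (induction rule: tensor_induct)
  case (tens x y)
  have "lact T x (ract T (lact T c b) y) = lact T (x \<otimes>\<^bsub>M\<^esub> c) (ract T b y)"
    using assms tens by (simp add: Z_closed casimirs_carrier lact_mult flip: lact_ract)
  also have "\<dots> = lact T c (lact T x (ract T b y))"
    using assms tens by (simp add: Z_closed casimirs_carrier lact_mult flip: Z_central)
  finally show ?case using assms tens by (simp add: ins_tens lact_Z_casimirs)
qed (simp_all add: assms ins_add lact_Z_casimirs lact_add Z_closed)

lemma B_simps:
  "carrier B = casimirs" "\<zero>\<^bsub>B\<^esub> = \<zero>\<^bsub>T\<^esub>" "b \<oplus>\<^bsub>B\<^esub> b' = b \<oplus>\<^bsub>T\<^esub> b'"
  "\<one>\<^bsub>B\<^esub> = tens \<one>\<^bsub>M\<^esub> \<one>\<^bsub>M\<^esub>" "k \<odot>\<^bsub>B\<^esub> b = lact T (k \<odot>\<^bsub>M\<^esub> \<one>\<^bsub>M\<^esub>) b"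
  by (simp_all add: casimir_algebra_def Let_def casimirs_def tens_def cls_def F_eq)

lemma B_mult: "b \<in> casimirs \<Longrightarrow> b' \<in> casimirs \<Longrightarrow> b \<otimes>\<^bsub>B\<^esub> b' = ins b b'"
  using casimir_mult_eq_ins[of b b'] by (simp add: casimir_algebra_def Let_def F_eq)

lemma abelian_group_B: "abelian_group B"
proof (rule abelian_groupI)
  show "\<exists>y \<in> carrier B. y \<oplus>\<^bsub>B\<^esub> x = \<zero>\<^bsub>B\<^esub>" if "x \<in> carrier B" for x
  proof
    have x: "x \<in> casimirs" using that by (simp add: B_simps)
    show "lact T (\<ominus>\<^bsub>M\<^esub> \<one>\<^bsub>M\<^esub>) x \<in> carrier B"
      using x by (auto simp: B_simps M.l_minus M.r_minus intro!: lact_casimirs)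
    show "lact T (\<ominus>\<^bsub>M\<^esub> \<one>\<^bsub>M\<^esub>) x \<oplus>\<^bsub>B\<^esub> x = \<zero>\<^bsub>B\<^esub>"
      using x by (simp add: B_simps lact_minus_one casimirs_carrier)
  qed
qed (auto simp: B_simps casimirs_carrier T.a_ac casimirs_add casimirs_zero)

lemma assoc_algebra_B: "assoc_algebra K B"
proof (intro assoc_algebra.intro assoc_algebra_axioms.intro)
  show "module K B"
    by (intro moduleI abelian_group_B N.R.cring_axioms)
      (simp_all add: B_simps scalar_Z lact_Z_casimirs casimirs_carrier M.smult_l_distr
        lact_add_left lact_add M.smult_assoc1 M.unit_smult_mult(1) lact_mult[symmetric])
  show "ring B"
  proof (intro ringI abelian_group_B monoidI)
  qed (simp_all add: B_simps B_mult ins_casimirs one_casimirs ins_ins casimirs_carrier ins_one_left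
      ins_one_right casimirs_add ins_add ins_add_left)
qed (simp_all add: B_simps B_mult scalar_Z lact_Z_casimirs ins_lact_left ins_lact Z_closed casimirs_carrier)

sublocale B: assoc_algebra K B
  by (rule assoc_algebra_B)

sublocale BB: ring_extension K B "\<lambda>k. k \<odot>\<^bsub>B\<^esub> \<one>\<^bsub>B\<^esub>"
  by (rule B.ring_extension_unit)

lemma separable_algebra_B_iff:
  "separable_algebra K B \<longleftrightarrow> (\<exists>u \<in> carrier BB.T. (\<forall>b \<in> casimirs. lact BB.T b u = ract BB.T u b) \<and>
    mult_map B u = tens \<one>\<^bsub>M\<^esub> \<one>\<^bsub>M\<^esub>)"
  unfolding separable_algebra_def BB.separable_extension_iff
  by (simp add: assoc_algebra_B B_simps(1) flip: B_simps(4))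

section \<open>The counit and the integrals of \<open>B\<close>\<close>

text \<open>Multiplying out the two sides of n b = b n shows commutation with the image of
  \<open>N\<close>.\<close>

lemma mult_map_Z:
  assumes "b \<in> casimirs"
  shows "mult_map M b \<in> Z"
  using assms mult_map_lact[of _ b] mult_map_ract[of _ b]
  by (simp add: centralizer_def casimirs_carrier flip: casimirsD)
    (metis casimirsD eta_closed)

text \<open>The factor \<open>b\<^sup>1b\<^sup>2\<close> is central in \<open>M\<close>, so it can
  be pulled out of \<open>xb\<^sup>1b\<^sup>2y\<close>. On \<open>B\<close> this is multiplicativity
  of the counit.\<close>

lemma mult_map_ins:
  assumes "b \<in> casimirs" "t \<in> carrier T"
  shows "mult_map M (ins b t) = mult_map M b \<otimes>\<^bsub>M\<^esub> mult_map M t"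
  using assms(2)
proof (induction rule: tensor_induct)
  case (tens x y)
  then show ?case
    using assms(1) Z_central[OF mult_map_Z[OF assms(1)], of x]
    by (simp add: ins_tens casimirs_carrier mult_map_lact mult_map_ract mult_map_tens M.m_assoc[symmetric])
qed (use assms in \<open>simp_all add: casimirs_carrier ins_add mult_map_add M.r_distr\<close>)

text \<open>Each element of \<open>Z\<close> is k1 for some k in \<open>K\<close>, so this is
  balancing over \<open>K\<close>.\<close>

lemma BB_tens_Z:
  assumes "c \<in> Z" "b \<in> casimirs" "b' \<in> casimirs"
  shows "BB.tens (lact T c b) b' = BB.tens b (lact T c b')"
proof -
  obtain k where k: "k \<in> carrier K" "c = k \<odot>\<^bsub>M\<^esub> \<one>\<^bsub>M\<^esub>" using Z_scalar[OF assms(1)] by blast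
  then have "lact T c b'' = k \<odot>\<^bsub>B\<^esub> b''" for b'' by (simp add: B_simps)
  then show ?thesis
    using BB.tens_balanced[of b k b'] k(1) assms by (simp add: B.unit_smult_mult B_simps(1))
qed

text \<open>The map \<open>\<epsilon> \<otimes> id\<close> from \<open>B \<otimes>\<^sub>K B\<close> to \<open>T\<close>.\<close>

definition counit_left where
  "counit_left = BB.lift T (\<lambda>b b'. lact T (mult_map M b) b')"

text \<open>Balancing holds because the counit is linear over \<open>K\<close> and its values
  commute with scalars.\<close>

lemma balanced_counit: "BB.balanced T (\<lambda>b b'. lact T (mult_map M b) b')"
  unfolding BB.balanced_def
proof (intro conjI ballI, goal_cases)
  case (4 b k b')
  then have b: "b \<in> casimirs" "b' \<in> casimirs" by (simp_all add: B_simps(1))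
  have "lact T (mult_map M b) (lact T (k \<odot>\<^bsub>M\<^esub> \<one>\<^bsub>M\<^esub>) b')
      = lact T (mult_map M (lact T (k \<odot>\<^bsub>M\<^esub> \<one>\<^bsub>M\<^esub>) b)) b'"
    using b 4(2) scalar_Z[OF 4(2)]
    by (simp add: casimirs_carrier Z_closed mult_map_lact lact_mult[symmetric]
        Z_central[of "k \<odot>\<^bsub>M\<^esub> \<one>\<^bsub>M\<^esub>" "mult_map M b"])
  then show ?case using 4 by (simp add: B.unit_smult_mult) (simp add: B_simps(5))
qed (auto simp: B_simps casimirs_carrier mult_map_add lact_add_left lact_add)

lemmas counit_left_additive = BB.lift_additive[OF T.abelian_group_axioms balanced_counit, folded counit_left_def]
  and counit_left_tens = BB.lift_tens[OF T.abelian_group_axioms balanced_counit, folded counit_left_def,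
    unfolded B_simps(1)]

lemma counit_left_lact:
  assumes "u \<in> carrier BB.T" "b \<in> casimirs"
  shows "counit_left (lact BB.T b u) = lact T (mult_map M b) (counit_left u)"
  using assms(1)
proof (induction rule: BB.tensor_induct)
  case (tens v w)
  then have vw: "v \<in> casimirs" "w \<in> casimirs" by (simp_all add: B_simps(1))
  then show ?case using assms(2)
    by (simp add: BB.lact_tens B_simps(1) B_mult counit_left_tens ins_casimirs mult_map_ins
        casimirs_carrier lact_mult)
next
  case (add u v)
  then show ?case using assms(2)
    by (simp add: BB.lact_add B_simps(1) additive_add[OF counit_left_additive]
        additive_closed[OF counit_left_additive] lact_add casimirs_carrier)
qed

text \<open>The counit value lies in \<open>Z\<close> and so pulls out of \<open>ins\<close>.
  Membership is proved jointly, since \<open>ins_add_left\<close> asks for N-central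
  summands.\<close>

lemma counit_left_ract:
  assumes "u \<in> carrier BB.T" "b \<in> casimirs"
  shows "counit_left u \<in> casimirs \<and> counit_left (ract BB.T u b) = ins (counit_left u) b"
  using assms(1)
proof (induction rule: BB.tensor_induct)
  case (tens v w)
  then have vw: "v \<in> casimirs" "w \<in> casimirs" by (simp_all add: B_simps(1))
  then show ?case using assms(2)
    by (simp add: BB.ract_tens B_simps(1) B_mult counit_left_tens ins_casimirs ins_lact_left mult_map_Z
        lact_Z_casimirs casimirs_carrier)
next
  case (add u v)
  then show ?case using assms(2)
    by (simp add: BB.ract_add B_simps(1) additive_add[OF counit_left_additive]
        casimirs_carrier casimirs_add ins_add_left)
qed

text \<open>Both sides are \<open>\<epsilon>(u\<^sup>1)\<epsilon>(u\<^sup>2)\<close>, by linearity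
  and multiplicativity of the counit.\<close>

lemma mult_map_counit_left:
  assumes "u \<in> carrier BB.T"
  shows "mult_map M (counit_left u) = mult_map M (mult_map B u)"
  using assms
proof (induction rule: BB.tensor_induct)
  case (tens v w)
  then have vw: "v \<in> casimirs" "w \<in> casimirs" by (simp_all add: B_simps(1))
  then show ?case
    by (simp add: BB.mult_map_tens B_simps(1) B_mult counit_left_tens mult_map_ins casimirs_carrier mult_map_lact)
next
  case (add u v)
  then have "mult_map B u \<in> casimirs" "mult_map B v \<in> casimirs"
    using BB.mult_map_closed by (simp_all add: B_simps(1))
  then show ?case using add
    by (simp add: BB.mult_map_add additive_add[OF counit_left_additive] additive_closed[OF counit_left_additive]
        mult_map_add B_simps(3) casimirs_carrier)
qed

text \<open>On a separability element u, \<open>counit_left\<close> turns b u into a scalar multiple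
  and u b into a product, so the image of u is a right integral. It is normalised because u
  multiplies to the unit.\<close>

lemma casimir_separable_imp_integral:
  assumes "separable_algebra K B"
  obtains t where "t \<in> casimirs" "\<And>b. b \<in> casimirs \<Longrightarrow> ins t b = lact T (mult_map M b) t"
    "mult_map M t = \<one>\<^bsub>M\<^esub>"
proof -
  obtain u where u: "u \<in> carrier BB.T" "\<And>b. b \<in> casimirs \<Longrightarrow> lact BB.T b u = ract BB.T u b"
    "mult_map B u = tens \<one>\<^bsub>M\<^esub> \<one>\<^bsub>M\<^esub>"
    using assms separable_algebra_B_iff by blast
  show thesis
  proof (rule that[of "counit_left u"])
    show "counit_left u \<in> casimirs" using counit_left_ract[OF u(1) one_casimirs] by blast
    show "ins (counit_left u) b = lact T (mult_map M b) (counit_left u)" if "b \<in> casimirs" for b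
      using counit_left_ract[OF u(1) that] counit_left_lact[OF u(1) that] u(2)[OF that] by simp
    show "mult_map M (counit_left u) = \<one>\<^bsub>M\<^esub>"
      using mult_map_counit_left[OF u(1)] u(3) by (simp add: mult_map_tens)
  qed
qed

end

section \<open>Separability\<close>

text \<open>Packages the data from \<open>depth_two_quasibasis\<close>, the common ground of both
  implications.\<close>

locale casimir_quasibasis = irreducible_algebra_extension K N M \<eta>
  for K :: "('k, 'x) ring_scheme" and N :: "('k, 'n, 'y) module_scheme"
    and M :: "('k, 'm, 'z) module_scheme" and \<eta> +
  fixes r :: nat and f and b
  assumes f_additive: "k < r \<Longrightarrow> f k \<in> additive_maps T M"
    and f_lact: "\<lbrakk>k < r; p \<in> carrier M; t \<in> carrier T\<rbrakk> \<Longrightarrow> f k (lact T p t) = p \<otimes>\<^bsub>M\<^esub> f k t"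
    and f_ract: "\<lbrakk>k < r; n \<in> carrier N; t \<in> carrier T\<rbrakk> \<Longrightarrow> f k (ract T t (\<eta> n)) = f k t \<otimes>\<^bsub>M\<^esub> \<eta> n"
    and b_casimirs: "k < r \<Longrightarrow> b k \<in> casimirs"
    and quasibasis: "t \<in> carrier T \<Longrightarrow> finsum T (\<lambda>k. lact T (f k t) (b k)) {..<r} = t"
begin

section \<open>From separability of \<open>B\<close> to separability of \<open>M\<close> over
  \<open>N\<close>\<close>

lemmas f_closed [simp, intro] = additive_closed[OF f_additive]
  and f_add = additive_add[OF f_additive]
lemmas b_carrier [simp, intro] = casimirs_carrier[OF b_casimirs]

text \<open>An M-N-bimodule map takes N-central elements to N-central ones; coefficients of Casimir
  elements are therefore scalars.\<close>

lemma f_Z: "k < r \<Longrightarrow> c \<in> casimirs \<Longrightarrow> f k c \<in> Z"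
  using f_lact[of k _ c] f_ract[of k _ c] casimirsD[of c]
  by (simp add: centralizer_def casimirs_carrier) (metis eta_closed casimirs_carrier)

lemma integral_central:
  assumes t: "t \<in> casimirs" "\<And>c. c \<in> casimirs \<Longrightarrow> ins t c = lact T (mult_map M c) t"
    and m: "m \<in> carrier M"
  shows "lact T m t = ract T t m"
proof -
  note tT = casimirs_carrier[OF t(1)]
  have 1: "tens \<one>\<^bsub>M\<^esub> m \<in> carrier T" using m by simp
  have mult_f: "mult_map M (lact T (f k (tens \<one>\<^bsub>M\<^esub> m)) (b k)) = f k (tens \<one>\<^bsub>M\<^esub> m) \<otimes>\<^bsub>M\<^esub> mult_map M (b k)"
    if "k < r" for k
    using that 1 by (simp add: mult_map_lact)
  \<comment> \<open>This form moves \<open>m\<close> into the argument of \<open>ins t\<close>,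
    where the quasibasis expansion applies.\<close>
  have "ract T t m = ins t (tens \<one>\<^bsub>M\<^esub> m)"
    using t m tT by (simp add: ins_tens)
  also have "\<dots> = ins t (finsum T (\<lambda>k. lact T (f k (tens \<one>\<^bsub>M\<^esub> m)) (b k)) {..<r})"
    by (simp add: quasibasis[OF 1])
  also have "\<dots> = finsum T (\<lambda>k. ins t (lact T (f k (tens \<one>\<^bsub>M\<^esub> m)) (b k))) {..<r}"
    using 1 by (intro additive_finsum[OF T.abelian_group_axioms T.abelian_group_axioms ins_additive[OF t(1)]]) auto
  \<comment> \<open>The coefficient leaves \<open>ins t\<close> on the left, the integral property
    replaces \<open>ins t (b k)\<close> by a multiple of \<open>t\<close>, and
    \<open>mult_map\<close> absorbs the coefficient again.\<close>
  also have "\<dots> = finsum T (\<lambda>k. lact T (mult_map M (lact T (f k (tens \<one>\<^bsub>M\<^esub> m)) (b k))) t) {..<r}"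
    using 1 t tT b_casimirs
    by (intro T.finsum_cong') (auto simp: ins_lact mult_f lact_mult)
  also have "\<dots> = lact T (finsum M (\<lambda>k. mult_map M (lact T (f k (tens \<one>\<^bsub>M\<^esub> m)) (b k))) {..<r}) t"
    using 1 tT by (intro additive_finsum[OF M.abelian_group_axioms T.abelian_group_axioms, symmetric]
      additiveI) (auto simp: lact_add_left)
  also have "finsum M (\<lambda>k. mult_map M (lact T (f k (tens \<one>\<^bsub>M\<^esub> m)) (b k))) {..<r}
      = mult_map M (finsum T (\<lambda>k. lact T (f k (tens \<one>\<^bsub>M\<^esub> m)) (b k)) {..<r})"
    using 1 by (intro additive_finsum[OF T.abelian_group_axioms M.abelian_group_axioms mult_map_additive, symmetric]) auto
  also have "\<dots> = m" using m by (simp add: quasibasis[OF 1] mult_map_tens)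
  finally show ?thesis by simp
qed

lemma casimir_separable_imp_separable:
  assumes "separable_algebra K B"
  shows "separable_extension N M \<eta>"
proof -
  obtain t where t: "t \<in> casimirs" "\<And>c. c \<in> casimirs \<Longrightarrow> ins t c = lact T (mult_map M c) t"
    "mult_map M t = \<one>\<^bsub>M\<^esub>"
    using casimir_separable_imp_integral[OF assms] by blast
  then show ?thesis
    unfolding separable_extension_iff using integral_central[OF t(1,2)] casimirs_carrier by blast
qed

section \<open>Applying the quasibasis maps to the first legs of a tensor\<close>

text \<open>For t = x \<otimes> y, the product c t over \<open>M\<close> lies in M \<otimes> M
  \<otimes> M (over \<open>N\<close>) with first two legs c x; \<open>f k\<close> is applied to
  those two.\<close>

definition \<Psi> where
  "\<Psi> k c = lift T (\<lambda>x y. tens (f k (ract T c x)) y)"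

lemma balanced_\<Psi>:
  assumes "k < r" "c \<in> carrier T"
  shows "balanced T (\<lambda>x y. tens (f k (ract T c x)) y)"
  using assms
  by (simp add: balanced_def ract_add_right f_add tens_add_left tens_add_right ract_mult f_ract tens_balanced)

lemmas \<Psi>_additive = lift_additive[OF T.abelian_group_axioms balanced_\<Psi>, folded \<Psi>_def]
  and \<Psi>_tens = lift_tens[OF T.abelian_group_axioms balanced_\<Psi>, folded \<Psi>_def]

text \<open>The case c = 1 \<otimes> 1; at a separability element of the extension it gives the
  right-hand legs of the one built in B \<otimes> B over \<open>K\<close>.\<close>

definition \<Phi> where
  "\<Phi> k = \<Psi> k (tens \<one>\<^bsub>M\<^esub> \<one>\<^bsub>M\<^esub>)"

lemma \<Phi>_additive: "k < r \<Longrightarrow> \<Phi> k \<in> additive_maps T T"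
  by (simp add: \<Phi>_def \<Psi>_additive)

lemma \<Phi>_tens:
  "\<lbrakk>k < r; x \<in> carrier M; y \<in> carrier M\<rbrakk> \<Longrightarrow> \<Phi> k (tens x y) = tens (f k (tens \<one>\<^bsub>M\<^esub> x)) y"
  by (simp add: \<Phi>_def \<Psi>_tens ract_tens)

lemmas \<Phi>_closed [simp, intro] = additive_closed[OF \<Phi>_additive]
  and \<Phi>_add = additive_add[OF \<Phi>_additive]
  and \<Psi>_closed [simp, intro] = additive_closed[OF \<Psi>_additive]
  and \<Psi>_add = additive_add[OF \<Psi>_additive]

text \<open>Since \<open>f k\<close> sees 1 \<otimes> x, only elements of \<open>N\<close> can be
  moved through the tensor sign and out on the left.\<close>

lemma \<Phi>_lact:
  assumes "k < r" "n \<in> carrier N" "t \<in> carrier T"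
  shows "\<Phi> k (lact T (\<eta> n) t) = lact T (\<eta> n) (\<Phi> k t)"
  using assms(3)
proof (induction rule: tensor_induct)
  case (tens x y)
  have "f k (tens \<one>\<^bsub>M\<^esub> (\<eta> n \<otimes>\<^bsub>M\<^esub> x)) = \<eta> n \<otimes>\<^bsub>M\<^esub> f k (tens \<one>\<^bsub>M\<^esub> x)"
    using assms tens f_lact[of k "\<eta> n" "tens \<one>\<^bsub>M\<^esub> x"] tens_balanced[of "\<one>\<^bsub>M\<^esub>" n x]
    by (simp add: lact_tens)
  then show ?case using assms tens by (simp add: \<Phi>_tens lact_tens)
qed (use assms in \<open>simp_all add: lact_add \<Phi>_add\<close>)

lemma \<Phi>_ract:
  assumes "k < r" "m \<in> carrier M" "t \<in> carrier T"
  shows "\<Phi> k (ract T t m) = ract T (\<Phi> k t) m"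
  using assms(3) by (induction rule: tensor_induct)
    (use assms in \<open>simp_all add: ract_add \<Phi>_add \<Phi>_tens ract_tens\<close>)

text \<open>Left linearity of \<open>f k\<close> extracts \<open>u\<close> from u \<otimes> vx and
  leaves 1 \<otimes> vx, the argument occurring in \<open>\<Phi>\<close>.\<close>

lemma \<Psi>_tens_left:
  assumes "k < r" "u \<in> carrier M" "v \<in> carrier M" "t \<in> carrier T"
  shows "\<Psi> k (tens u v) t = lact T u (\<Phi> k (lact T v t))"
  using assms(4)
proof (induction rule: tensor_induct)
  case (tens x y)
  have "f k (tens u (v \<otimes>\<^bsub>M\<^esub> x)) = u \<otimes>\<^bsub>M\<^esub> f k (tens \<one>\<^bsub>M\<^esub> (v \<otimes>\<^bsub>M\<^esub> x))"
    using assms tens f_lact[of k u "tens \<one>\<^bsub>M\<^esub> (v \<otimes>\<^bsub>M\<^esub> x)"] by (simp add: lact_tens)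
  then show ?case using assms tens by (simp add: \<Phi>_tens \<Psi>_tens lact_tens ract_tens)
qed (use assms in \<open>simp_all add: lact_add \<Phi>_add \<Psi>_add\<close>)

lemma \<Psi>_add_left:
  assumes "k < r" "c \<in> carrier T" "d \<in> carrier T" "t \<in> carrier T"
  shows "\<Psi> k (c \<oplus>\<^bsub>T\<^esub> d) t = \<Psi> k c t \<oplus>\<^bsub>T\<^esub> \<Psi> k d t"
  using assms(4) by (induction rule: tensor_induct)
    (use assms in \<open>simp_all add: \<Psi>_add \<Psi>_tens ract_add f_add tens_add_left T.a_ac\<close>)

text \<open>On x \<otimes> y the sum is the quasibasis expansion of 1 \<otimes> x, multiplied by
  \<open>y\<close> on the right.\<close>

lemma sum_ins_\<Phi>:
  assumes "t \<in> carrier T"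
  shows "finsum T (\<lambda>k. ins (b k) (\<Phi> k t)) {..<r} = tens \<one>\<^bsub>M\<^esub> (mult_map M t)"
  using assms
proof (induction rule: tensor_induct)
  case (tens x y)
  then have 1: "tens \<one>\<^bsub>M\<^esub> x \<in> carrier T" by simp
  have "finsum T (\<lambda>k. ins (b k) (\<Phi> k (tens x y))) {..<r}
      = finsum T (\<lambda>k. ract T (lact T (f k (tens \<one>\<^bsub>M\<^esub> x)) (b k)) y) {..<r}"
    using 1 tens b_casimirs by (intro T.finsum_cong') (auto simp: \<Phi>_tens ins_tens lact_ract)
  also have "\<dots> = ract T (finsum T (\<lambda>k. lact T (f k (tens \<one>\<^bsub>M\<^esub> x)) (b k)) {..<r}) y"
    using 1 tens
    by (intro additive_finsum[OF T.abelian_group_axioms T.abelian_group_axioms ract_additive, symmetric]) auto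
  also have "\<dots> = tens \<one>\<^bsub>M\<^esub> (x \<otimes>\<^bsub>M\<^esub> y)" using tens by (simp add: quasibasis[OF 1] ract_tens)
  finally show ?case using tens by (simp add: mult_map_tens)
next
  case (add u v)
  have "finsum T (\<lambda>k. ins (b k) (\<Phi> k (u \<oplus>\<^bsub>T\<^esub> v))) {..<r}
      = finsum T (\<lambda>k. ins (b k) (\<Phi> k u) \<oplus>\<^bsub>T\<^esub> ins (b k) (\<Phi> k v)) {..<r}"
    using add b_casimirs by (intro T.finsum_cong') (auto simp: \<Phi>_add ins_add)
  also have "\<dots> = finsum T (\<lambda>k. ins (b k) (\<Phi> k u)) {..<r} \<oplus>\<^bsub>T\<^esub> finsum T (\<lambda>k. ins (b k) (\<Phi> k v)) {..<r}"
    using add b_casimirs by (intro T.finsum_addf) auto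
  finally show ?case using add by (simp add: mult_map_add tens_add_right)
qed

text \<open>Expands \<open>c b\<^sub>k = \<Sum>\<^sub>l f\<^sub>l(c b\<^sub>k) b\<^sub>l\<close> with scalar coefficients, collected over \<open>k\<close>: this turns left
  multiplication by \<open>c\<close> of the separability element into right multiplication.\<close>

lemma sum_f_\<Phi>:
  assumes l: "l < r" and c: "c \<in> casimirs" and t: "t \<in> carrier T"
  shows "finsum T (\<lambda>k. lact T (f l (ins c (b k))) (\<Phi> k t)) {..<r} = \<Psi> l c t"
  using t
proof (induction rule: tensor_induct)
  case (tens x y)
  then have 1: "tens \<one>\<^bsub>M\<^esub> x \<in> carrier T" by simp
  note cT = casimirs_carrier[OF c]
  let ?g = "\<lambda>z. tens (f l (ins c z)) y"
  have g: "?g \<in> additive_maps T T"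
    using l c tens by (intro additiveI) (auto simp: ins_add f_add tens_add_left)
  have step: "lact T (f l (ins c (b k))) (\<Phi> k (tens x y)) = ?g (lact T (f k (tens \<one>\<^bsub>M\<^esub> x)) (b k))"
    if k: "k < r" for k
  proof -
    \<comment> \<open>As \<open>ins c (b k)\<close> is again a Casimir element, its coefficient is
      central.\<close>
    have "f l (ins c (b k)) \<otimes>\<^bsub>M\<^esub> f k (tens \<one>\<^bsub>M\<^esub> x) = f k (tens \<one>\<^bsub>M\<^esub> x) \<otimes>\<^bsub>M\<^esub> f l (ins c (b k))"
      using l k c 1 by (intro Z_central f_Z ins_casimirs b_casimirs) auto
    then show ?thesis using l k c 1 tens
      by (simp add: \<Phi>_tens lact_tens ins_lact f_lact)
  qed
  have "finsum T (\<lambda>k. lact T (f l (ins c (b k))) (\<Phi> k (tens x y))) {..<r}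
      = finsum T (\<lambda>k. ?g (lact T (f k (tens \<one>\<^bsub>M\<^esub> x)) (b k))) {..<r}"
    using l c 1 tens by (intro T.finsum_cong') (auto simp: step)
  also have "\<dots> = ?g (finsum T (\<lambda>k. lact T (f k (tens \<one>\<^bsub>M\<^esub> x)) (b k)) {..<r})"
    using 1 by (intro additive_finsum[OF T.abelian_group_axioms T.abelian_group_axioms g, symmetric]) auto
  also have "\<dots> = \<Psi> l c (tens x y)"
    using l c cT tens by (simp add: quasibasis[OF 1] ins_tens \<Psi>_tens)
  finally show ?case .
next
  case (add u v)
  have "finsum T (\<lambda>k. lact T (f l (ins c (b k))) (\<Phi> k (u \<oplus>\<^bsub>T\<^esub> v))) {..<r}
      = finsum T (\<lambda>k. lact T (f l (ins c (b k))) (\<Phi> k u) \<oplus>\<^bsub>T\<^esub> lact T (f l (ins c (b k))) (\<Phi> k v)) {..<r}"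
    using add l c by (intro T.finsum_cong') (auto simp: \<Phi>_add lact_add)
  also have "\<dots> = finsum T (\<lambda>k. lact T (f l (ins c (b k))) (\<Phi> k u)) {..<r}
      \<oplus>\<^bsub>T\<^esub> finsum T (\<lambda>k. lact T (f l (ins c (b k))) (\<Phi> k v)) {..<r}"
    using add l c by (intro T.finsum_addf) auto
  finally show ?case using add l casimirs_carrier[OF c] by (simp add: \<Psi>_add)
qed

text \<open>The inclusion of \<open>B\<close> into \<open>T\<close> is additive, so expansions in
  \<open>T\<close> can be read in \<open>B\<close>.\<close>

lemma finsum_B:
  assumes "finite I" "\<And>i. i \<in> I \<Longrightarrow> g i \<in> casimirs"
  shows "finsum B g I = finsum T g I"
proof -
  have "(\<lambda>x. x) \<in> additive_maps B T"
    by (intro additiveI) (auto simp: B_simps casimirs_carrier)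
  from additive_finsum[OF abelian_group_B T.abelian_group_axioms this assms(1), of g] assms(2)
  show ?thesis by (simp add: B_simps(1))
qed

section \<open>From separability of \<open>M\<close> over \<open>N\<close> to separability of
  \<open>B\<close>\<close>

context
  fixes e
  assumes e: "e \<in> carrier T" "\<And>m. m \<in> carrier M \<Longrightarrow> lact T m e = ract T e m" "mult_map M e = \<one>\<^bsub>M\<^esub>"
begin

text \<open>Left and right \<open>N\<close>-linearity of \<open>\<Phi> k\<close> transport n e = e
  n.\<close>

lemma \<Phi>_casimirs: "k < r \<Longrightarrow> \<Phi> k e \<in> casimirs"
  using e by (simp add: casimirs_def flip: \<Phi>_lact \<Phi>_ract)

text \<open>For c = u \<otimes> v the left side is u \<open>\<Phi> k\<close>(v e) = u
  \<open>\<Phi> k\<close>(e v) = u \<open>\<Phi> k\<close>(e) v, since e commutes with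
  \<open>v\<close>.\<close>

lemma \<Psi>_eq_ins:
  assumes "k < r" "c \<in> carrier T"
  shows "\<Psi> k c e = ins (\<Phi> k e) c"
  using assms(2) by (induction rule: tensor_induct)
    (use assms e \<Phi>_casimirs[OF assms(1)] in
      \<open>simp_all add: \<Psi>_tens_left \<Phi>_ract ins_tens \<Psi>_add_left ins_add\<close>)

text \<open>The product of the legs is 1 \<otimes> 1 by \<open>sum_ins_\<Phi>\<close>. For
  commutation, each product of \<open>c\<close> with \<open>b k\<close> is expanded in the
  \<open>b l\<close>, the scalar coefficients cross to the right leg, and the sum over
  \<open>k\<close> turns the right leg into \<open>\<Phi> l e\<close> times
  \<open>c\<close>.\<close>

lemma separating_element:
  defines "u \<equiv> finsum BB.T (\<lambda>k. BB.tens (b k) (\<Phi> k e)) {..<r}"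
  shows "u \<in> carrier BB.T" "mult_map B u = tens \<one>\<^bsub>M\<^esub> \<one>\<^bsub>M\<^esub>"
    "\<And>c. c \<in> casimirs \<Longrightarrow> lact BB.T c u = ract BB.T u c"
proof -
  note cas [simp] = b_casimirs \<Phi>_casimirs
  have tens_closed: "BB.tens v w \<in> carrier BB.T" if "v \<in> casimirs" "w \<in> casimirs" for v w
    using that BB.tens_closed by (simp add: B_simps(1))
  show u: "u \<in> carrier BB.T" unfolding u_def by (intro BB.T.finsum_closed) (auto intro!: tens_closed)
  have "mult_map B u = finsum B (\<lambda>k. mult_map B (BB.tens (b k) (\<Phi> k e))) {..<r}"
    unfolding u_def
    by (intro additive_finsum[OF BB.T.abelian_group_axioms abelian_group_B BB.mult_map_additive])
      (auto intro!: tens_closed)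
  also have "\<dots> = finsum B (\<lambda>k. ins (b k) (\<Phi> k e)) {..<r}"
    by (intro B.finsum_cong') (auto simp: BB.mult_map_tens B_simps(1) B_mult ins_casimirs)
  also have "\<dots> = finsum T (\<lambda>k. ins (b k) (\<Phi> k e)) {..<r}"
    by (intro finsum_B) (auto simp: ins_casimirs)
  finally show "mult_map B u = tens \<one>\<^bsub>M\<^esub> \<one>\<^bsub>M\<^esub>" using e by (simp add: sum_ins_\<Phi>)
  show "lact BB.T c u = ract BB.T u c" if c: "c \<in> casimirs" for c
  proof -
    \<comment> \<open>The scalar matrix of left multiplication by \<open>c\<close> with respect to
      the quasibasis.\<close>
    let ?s = "\<lambda>k l. f l (ins c (b k))"
    have s: "?s k l \<in> Z" if "k < r" "l < r" for k l
      using that c by (intro f_Z ins_casimirs) auto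
    have tens_left: "(\<lambda>v. BB.tens v w) \<in> additive_maps B BB.T" if "w \<in> casimirs" for w
      using that by (intro additiveI) (auto simp: B_simps(1) BB.tens_add_left intro!: tens_closed)
    have tens_right: "BB.tens v \<in> additive_maps B BB.T" if "v \<in> casimirs" for v
      using that by (intro additiveI) (auto simp: B_simps(1) BB.tens_add_right intro!: tens_closed)
    have expand: "BB.tens (ins c (b k)) (\<Phi> k e)
        = finsum BB.T (\<lambda>l. BB.tens (b l) (lact T (?s k l) (\<Phi> k e))) {..<r}" if k: "k < r" for k
    proof -
      have "ins c (b k) = finsum B (\<lambda>l. lact T (?s k l) (b l)) {..<r}"
        using k c s by (subst finsum_B) (auto simp: quasibasis lact_Z_casimirs)
      then have "BB.tens (ins c (b k)) (\<Phi> k e)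
          = finsum BB.T (\<lambda>l. BB.tens (lact T (?s k l) (b l)) (\<Phi> k e)) {..<r}"
        using k s additive_finsum[OF abelian_group_B BB.T.abelian_group_axioms tens_left[OF \<Phi>_casimirs[OF k]],
            of "{..<r}" "\<lambda>l. lact T (?s k l) (b l)"]
        by (simp add: B_simps(1) lact_Z_casimirs)
      \<comment> \<open>The entries lie in \<open>Z\<close>, so they cross the tensor sign over
        \<open>K\<close>.\<close>
      also have "\<dots> = finsum BB.T (\<lambda>l. BB.tens (b l) (lact T (?s k l) (\<Phi> k e))) {..<r}"
        using k s by (intro BB.T.finsum_cong') (auto simp: BB_tens_Z lact_Z_casimirs intro!: tens_closed)
      finally show ?thesis .
    qed
    have collect: "finsum BB.T (\<lambda>k. BB.tens (b l) (lact T (?s k l) (\<Phi> k e))) {..<r}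
        = BB.tens (b l) (ins (\<Phi> l e) c)" if l: "l < r" for l
    proof -
      have "finsum BB.T (\<lambda>k. BB.tens (b l) (lact T (?s k l) (\<Phi> k e))) {..<r}
          = BB.tens (b l) (finsum B (\<lambda>k. lact T (?s k l) (\<Phi> k e)) {..<r})"
        using l s by (intro additive_finsum[OF abelian_group_B BB.T.abelian_group_axioms tens_right, symmetric])
          (auto simp: B_simps(1) lact_Z_casimirs)
      \<comment> \<open>The sum is \<open>\<Psi> l c e\<close> by \<open>sum_f_\<Phi>\<close>;
        commutation of e with \<open>M\<close> makes it a product in \<open>B\<close>.\<close>
      also have "finsum B (\<lambda>k. lact T (?s k l) (\<Phi> k e)) {..<r} = ins (\<Phi> l e) c"
        using l s c e(1)
        by (subst finsum_B) (auto simp: lact_Z_casimirs sum_f_\<Phi> \<Psi>_eq_ins casimirs_carrier)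
      finally show ?thesis .
    qed
    have "lact BB.T c u = finsum BB.T (\<lambda>k. lact BB.T c (BB.tens (b k) (\<Phi> k e))) {..<r}"
      unfolding u_def using c
      by (intro additive_finsum[OF BB.T.abelian_group_axioms BB.T.abelian_group_axioms BB.lact_additive])
        (auto simp: B_simps(1) intro!: tens_closed)
    also have "\<dots> = finsum BB.T (\<lambda>k. finsum BB.T (\<lambda>l. BB.tens (b l) (lact T (?s k l) (\<Phi> k e))) {..<r}) {..<r}"
      using c s by (intro BB.T.finsum_cong')
        (auto simp: BB.lact_tens B_simps(1) B_mult lact_Z_casimirs simp flip: expand intro!: BB.T.finsum_closed tens_closed ins_casimirs)
    also have "\<dots> = finsum BB.T (\<lambda>l. finsum BB.T (\<lambda>k. BB.tens (b l) (lact T (?s k l) (\<Phi> k e))) {..<r}) {..<r}"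
      using s by (intro abelian_group_finsum_swap BB.T.abelian_group_axioms) (auto intro!: tens_closed lact_Z_casimirs)
    also have "\<dots> = finsum BB.T (\<lambda>l. ract BB.T (BB.tens (b l) (\<Phi> l e)) c) {..<r}"
      using c by (intro BB.T.finsum_cong')
        (auto simp: collect BB.ract_tens B_simps(1) B_mult intro!: tens_closed ins_casimirs)
    also have "\<dots> = ract BB.T u c"
      unfolding u_def using c
      by (intro additive_finsum[OF BB.T.abelian_group_axioms BB.T.abelian_group_axioms BB.ract_additive, symmetric])
        (auto simp: B_simps(1) intro!: tens_closed)
    finally show ?thesis .
  qed
qed

end

lemma separable_imp_casimir_separable:
  assumes "separable_extension N M \<eta>"
  shows "separable_algebra K B"
proof -
  obtain e where e: "e \<in> carrier T" "\<And>m. m \<in> carrier M \<Longrightarrow> lact T m e = ract T e m"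
    "mult_map M e = \<one>\<^bsub>M\<^esub>"
    using assms unfolding separable_extension_iff by blast
  show ?thesis
    unfolding separable_algebra_B_iff using separating_element[OF e] by blast
qed

end

theorem proposition8p4:
  fixes K :: "('k, 'x) ring_scheme"
    and N :: "('k, 'n, 'y) module_scheme"
    and M :: "('k, 'm, 'z) module_scheme"
    and \<eta> :: "'n \<Rightarrow> 'm"
  assumes "algebra_extension K N M \<eta>"
    and "irreducible_extension K N M \<eta>"
    and "depth_two N M \<eta>"
    and "frobenius_extension N M \<eta>"
  shows "separable_extension N M \<eta> \<longleftrightarrow> separable_algebra K (casimir_algebra N M \<eta>)"
proof -
  interpret irreducible_algebra_extension K N M \<eta>
    using assms(1,2) by (intro irreducible_algebra_extension.intro irreducible_algebra_extension_axioms.intro)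
  obtain r f b where "casimir_quasibasis K N M \<eta> r f b"
  proof (rule depth_two_quasibasis[OF assms(3)])
    fix r :: nat and f b
    assume "\<And>k. k < r \<Longrightarrow> f k \<in> additive_maps T M"
      "\<And>k p t. \<lbrakk>k < r; p \<in> carrier M; t \<in> carrier T\<rbrakk> \<Longrightarrow> f k (lact T p t) = p \<otimes>\<^bsub>M\<^esub> f k t"
      "\<And>k n t. \<lbrakk>k < r; n \<in> carrier N; t \<in> carrier T\<rbrakk> \<Longrightarrow> f k (ract T t (\<eta> n)) = f k t \<otimes>\<^bsub>M\<^esub> \<eta> n"
      "\<And>k. k < r \<Longrightarrow> b k \<in> casimirs"
      "\<And>t. t \<in> carrier T \<Longrightarrow> finsum T (\<lambda>k. lact T (f k t) (b k)) {..<r} = t"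
    then have "casimir_quasibasis K N M \<eta> r f b"
      by (intro casimir_quasibasis.intro casimir_quasibasis_axioms.intro irreducible_algebra_extension_axioms)
    then show thesis by (rule that)
  qed
  then show ?thesis
    using casimir_quasibasis.separable_imp_casimir_separable casimir_quasibasis.casimir_separable_imp_separable
    by blast
qed

end
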